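(* Let $k\ge2$ be an integer. For every $w\in\mathcal{M}^*$, $$\mathrm{DF}'(w)=\{\boldsymbol\alpha\in\Delta:\mathcal{I}(\boldsymbol\alpha)\le w\}=\mathrm{DF}(w);$$ that is, the digit frequency set of the symbolic $\beta$-shift $X(w)$ does not depend on whether or not it is defined subsequentially. Moreover, for every $\beta\in(k-1,k)$, the digit frequency set $\mathrm{DF}(\beta)$ of $\beta$-expansions can be written as $\mathrm{DF}(w)$ for an appropriate $w\in\mathcal{M}^*$, so that it too can be defined subsequentially without affecting its value: $\mathrm{DF}'(\beta)=\mathrm{DF}(\beta)$.
   Context: $\mathbb{N}$ includes $0$. Fix an integer $k\ge2$. Let $\Sigma=\{0,1,\ldots,k-1\}^{\mathbb{N}}$ with the lexicographic order and product topology, and let $\sigma:\Sigma\to\Sigma$ be the shift, $\sigma(w)_r=w_{r+1}$. An overline denotes infinite repetition. $\mathcal{M}^*$ is the set of $w\in\Sigma$ which are maximal ($\sigma^r(w)\le w$ for all $r\ge0$) and satisfy $w_0=k-1$. For $w\in\mathcal{M}^*$, the symbolic $\beta$-shift is $X(w)=\{v\in\Sigma:\sigma^r(v)\le w\text{ for all }r\in\mathbb{N}\}$. Let $\Delta=\{\boldsymbol\alpha\in\mathbb{R}^k_{\ge0}:\sum_{i=0}^{k-1}\alpha_i=1\}$, and let $N_{i,r}(v)$ be the number of digits equal to $i$ among the first $r$ entries of $v\in\Sigma$. For $w\in\mathcal{M}^*$, $\mathrm{DF}(w)$ is the set of $\boldsymbol\alpha\in\Delta$ for which there is some $v\in X(w)$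 with $\lim_{r\to\infty}N_{i,r}(v)/r=\alpha_i$ for each $i$; and $\mathrm{DF}'(w)$ is the set of $\boldsymbol\alpha\in\Delta$ for which there are some $v\in X(w)$ and some sequence $r_s\to\infty$ with $\lim_{s\to\infty}N_{i,r_s}(v)/r_s=\alpha_i$ for each $i$. The function $\mathcal{I}:\Delta\to\Sigma$ is defined as follows. Let $\Delta'=\{\boldsymbol\alpha\in\Delta:\alpha_{k-1}\ne0\}$. For $\boldsymbol\alpha\in\Delta'$ put $J(\boldsymbol\alpha)=\lfloor\alpha_0/\alpha_{k-1}\rfloor$ and define $K:\Delta'\to\Delta'$ by $$K(\boldsymbol\alpha)=\left(\frac{\alpha_1}{1-\alpha_0},\frac{\alpha_2}{1-\alpha_0},\ldots,\frac{\alpha_{k-2}}{1-\alpha_0},\frac{\alpha_0-n\alpha_{k-1}}{1-\alpha_0},\frac{(n+1)\alpha_{k-1}-\alpha_0}{1-\alpha_0}\right),\quad n=J(\boldsymbol\alpha).$$ Let $n_r=J(K^r(\boldsymbol\alpha))$ for $r\ge0$. For $n\in\mathbb{N}$ let $\Lambda_n$ be the substitution $i\mapsto(i+1)$ for $0\le i\le k-3$, $(k-2)\mapsto(k-1)\,0^{n+1}$, $(k-1)\mapsto(k-1)\,0^n$. Then $\mathcal{I}(\boldsymbol\alpha)=\lim_{r\to\infty}\Lambda_{n_0}\circ\Lambda_{n_1}\circ\cdots\circ\Lambda_{n_r}(\overline{k-1})$ for $\boldsymbol\alpha\in\Delta'$ (this is the infimum of the set of maximal sequences with digit frequency $\boldsymbol\alpha$),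 and $\mathcal{I}(\boldsymbol\alpha)=(k-1)\,\overline{0}$ for $\boldsymbol\alpha\in\Delta\setminus\Delta'$. For $\beta\in(k-1,k)$ and $x\in[0,1]$, the greedy $\beta$-expansion $d_\beta(x)\in\Sigma$ is the lexicographically greatest $v\in\Sigma$ with $x=\sum_{r\ge0}v_r\beta^{-(r+1)}$. $\mathrm{DF}(\beta)$ is the set of $\boldsymbol\alpha\in\Delta$ for which there is some $x\in[0,1]$ with $\lim_{r\to\infty}N_{i,r}(d_\beta(x))/r=\alpha_i$ for each $i$; and $\mathrm{DF}'(\beta)$ is the set of $\boldsymbol\alpha\in\Delta$ for which there are some $x\in[0,1]$ and some sequence $r_s\to\infty$ with $\lim_{s\to\infty}N_{i,r_s}(d_\beta(x))/r_s=\alpha_i$ for each $i$. *)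

theory Defs
  imports "HOL-Analysis.Analysis" "HOL-Library.Fun_Lexorder"
begin

definition seqs :: "nat \<Rightarrow> (nat \<Rightarrow> nat) set" where
  "seqs k = {w. \<forall>r. w r < k}"

(* The class order on nat => nat is pointwise, so the lexicographic order needs its own
   symbol. *)
definition lex_le :: "(nat \<Rightarrow> nat) \<Rightarrow> (nat \<Rightarrow> nat) \<Rightarrow> bool" (infix "\<preceq>" 50) where
  "v \<preceq> w \<longleftrightarrow> v = w \<or> less_fun v w"

definition shift :: "(nat \<Rightarrow> nat) \<Rightarrow> nat \<Rightarrow> nat" where
  "shift w = (\<lambda>r. w (r + 1))"

definition maximal_seqs :: "nat \<Rightarrow> (nat \<Rightarrow> nat) set" where
  "maximal_seqs k = {w \<in> seqs k. (\<forall>r. (shift ^^ r) w \<preceq> w) \<and> w 0 = k - 1}"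

definition beta_shift :: "nat \<Rightarrow> (nat \<Rightarrow> nat) \<Rightarrow> (nat \<Rightarrow> nat) set" where
  "beta_shift k w = {v \<in> seqs k. \<forall>r. (shift ^^ r) v \<preceq> w}"

(* Vectors of R^k are functions on nat that vanish from index k on. *)
definition freq_simplex :: "nat \<Rightarrow> (nat \<Rightarrow> real) set" where
  "freq_simplex k =
     {\<alpha>. (\<forall>i<k. 0 \<le> \<alpha> i) \<and> (\<forall>i\<ge>k. \<alpha> i = 0) \<and> (\<Sum>i<k. \<alpha> i) = 1}"

definition digit_count :: "nat \<Rightarrow> nat \<Rightarrow> (nat \<Rightarrow> nat) \<Rightarrow> nat" where
  "digit_count i r v = card {j. j < r \<and> v j = i}"

definition has_freq :: "nat \<Rightarrow> (nat \<Rightarrow> nat) \<Rightarrow> (nat \<Rightarrow> real) \<Rightarrow> bool" where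
  "has_freq k v \<alpha> \<longleftrightarrow>
     (\<forall>i<k. (\<lambda>r. real (digit_count i r v) / real r) \<longlonglongrightarrow> \<alpha> i)"

definition has_subseq_freq :: "nat \<Rightarrow> (nat \<Rightarrow> nat) \<Rightarrow> (nat \<Rightarrow> real) \<Rightarrow> bool" where
  "has_subseq_freq k v \<alpha> \<longleftrightarrow>
     (\<exists>\<rho> :: nat \<Rightarrow> nat. filterlim \<rho> at_top sequentially \<and>
        (\<forall>i<k. (\<lambda>s. real (digit_count i (\<rho> s) v) / real (\<rho> s)) \<longlonglongrightarrow> \<alpha> i))"

definition DF :: "nat \<Rightarrow> (nat \<Rightarrow> nat) \<Rightarrow> (nat \<Rightarrow> real) set" where
  "DF k w = {\<alpha> \<in> freq_simplex k. \<exists>v \<in> beta_shift k w. has_freq k v \<alpha>}"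

definition DF' :: "nat \<Rightarrow> (nat \<Rightarrow> nat) \<Rightarrow> (nat \<Rightarrow> real) set" where
  "DF' k w = {\<alpha> \<in> freq_simplex k. \<exists>v \<in> beta_shift k w. has_subseq_freq k v \<alpha>}"

definition J_map :: "nat \<Rightarrow> (nat \<Rightarrow> real) \<Rightarrow> nat" where
  "J_map k \<alpha> = nat \<lfloor>\<alpha> 0 / \<alpha> (k - 1)\<rfloor>"

definition K_map :: "nat \<Rightarrow> (nat \<Rightarrow> real) \<Rightarrow> nat \<Rightarrow> real" where
  "K_map k \<alpha> = (let n = real (J_map k \<alpha>) in
     (\<lambda>i. if i < k - 2 then \<alpha> (i + 1) / (1 - \<alpha> 0)
          else if i = k - 2 then (\<alpha> 0 - n * \<alpha> (k - 1)) / (1 - \<alpha> 0)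
          else if i = k - 1 then ((n + 1) * \<alpha> (k - 1) - \<alpha> 0) / (1 - \<alpha> 0)
          else 0))"

definition subst_digit :: "nat \<Rightarrow> nat \<Rightarrow> nat \<Rightarrow> nat list" where
  "subst_digit k n i =
     (if i = k - 1 then (k - 1) # replicate n 0
      else if i = k - 2 then (k - 1) # replicate (n + 1) 0
      else [i + 1])"

(* Images of digits are nonempty, so the images of the first m + 1 digits of v together
   already contain the entry at position m of the infinite concatenation. *)
definition subst_seq :: "nat \<Rightarrow> nat \<Rightarrow> (nat \<Rightarrow> nat) \<Rightarrow> nat \<Rightarrow> nat" where
  "subst_seq k n v = (\<lambda>m. concat (map (\<lambda>j. subst_digit k n (v j)) [0..<Suc m]) ! m)"

(* The foldr term is the composition of the substitutions for n_0, ..., n_r, the one for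
   n_r being applied first. Convergence is in the product topology on nat => nat; "lim" is
   not available because the library does not make this type an instance of t2_space. *)
definition inf_seq :: "nat \<Rightarrow> (nat \<Rightarrow> real) \<Rightarrow> nat \<Rightarrow> nat" where
  "inf_seq k \<alpha> =
     (if \<alpha> (k - 1) \<noteq> 0
      then (THE v. (\<lambda>r. foldr (\<lambda>j. subst_seq k (J_map k ((K_map k ^^ j) \<alpha>))) [0..<Suc r] (\<lambda>_. k - 1))
                     \<longlonglongrightarrow> v)
      else (\<lambda>m. if m = 0 then k - 1 else 0))"

definition is_expansion :: "nat \<Rightarrow> real \<Rightarrow> real \<Rightarrow> (nat \<Rightarrow> nat) \<Rightarrow> bool" where
  "is_expansion k \<beta> x v \<longleftrightarrow> v \<in> seqs k \<and> (\<lambda>r. real (v r) / \<beta> ^ (r + 1)) sums x"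

definition greedy :: "nat \<Rightarrow> real \<Rightarrow> real \<Rightarrow> nat \<Rightarrow> nat" where
  "greedy k \<beta> x =
     (THE v. is_expansion k \<beta> x v \<and> (\<forall>u. is_expansion k \<beta> x u \<longrightarrow> u \<preceq> v))"

definition DF_beta :: "nat \<Rightarrow> real \<Rightarrow> (nat \<Rightarrow> real) set" where
  "DF_beta k \<beta> = {\<alpha> \<in> freq_simplex k. \<exists>x \<in> {0..1}. has_freq k (greedy k \<beta> x) \<alpha>}"

definition DF_beta' :: "nat \<Rightarrow> real \<Rightarrow> (nat \<Rightarrow> real) set" where
  "DF_beta' k \<beta> = {\<alpha> \<in> freq_simplex k. \<exists>x \<in> {0..1}. has_subseq_freq k (greedy k \<beta> x) \<alpha>}"

end

(* Both halves climb the tower of substitutions by which I(alpha) is defined.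

   Necessity: if w < I(alpha), then w is already smaller within a prefix p of I(alpha) that is the
   image of a power of k-1 under finitely many of the substitutions. Pulling the coordinate k-1
   back through the tower gives a linear functional g with g . alpha > 0, positive only at the
   digit k-1. Desubstituting words all of whose suffixes are smaller than p shows that the sums of
   g over them are bounded, so a sequence in X(w) cannot have frequency alpha even along a
   subsequence.

   Sufficiency: call a word good if each of its nonempty suffixes is smaller than I(alpha) at a
   position inside the suffix. Good words can be concatenated freely and are preserved by the
   substitutions. Take a word approximating the r-th iterate of alpha under K, carry it down the
   tower, and delete the leading k-1 from the image of each of its digits k-1. The result is good,
   and for large r the deletion hardly changes the frequencies, so good words approximate every
   alpha. A suitable infinite concatenation of them has frequency alpha, and all its shifts are
   strictly smaller than I(alpha).

   For beta-expansions w is the quasi-greedy expansion of 1. Greedy expansions either lie in X(w)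
   or end in zeros, and sequences all of whose shifts are strictly smaller than w are greedy; the
   strictness obtained above is what makes the realizing sequence an expansion. *)

theory Submission
  imports Defs
begin

section \<open>Lexicographic order\<close>

lemma shift_funpow: "(shift ^^ r) w = (\<lambda>i. w (i + r))"
  by (induction r) (auto simp: shift_def fun_eq_iff)

lemma less_fun_lex_le_trans: "less_fun u v \<Longrightarrow> v \<preceq> w \<Longrightarrow> less_fun u w"
  by (auto simp: lex_le_def intro: less_fun_trans)

lemma lex_le_antisym: "u \<preceq> v \<Longrightarrow> v \<preceq> u \<Longrightarrow> u = v"
  by (auto simp: lex_le_def dest: less_fun_asym)

lemma lex_linear: "u \<preceq> v \<or> less_fun v u" for u v :: "nat \<Rightarrow> nat"
proof (cases "u = v")
  case False
  define m where "m = (LEAST i. u i \<noteq> v i)"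
  have "u m \<noteq> v m"
    using False LeastI_ex[of "\<lambda>i. u i \<noteq> v i"] unfolding m_def by blast
  moreover have "\<forall>i<m. u i = v i"
    unfolding m_def using not_less_Least by blast
  ultimately show ?thesis
    by (metis less_fun_def lex_le_def linorder_neqE_nat)
qed (simp add: lex_le_def)

section \<open>Prefixes of sequences and convergence\<close>

definition agree :: "nat \<Rightarrow> (nat \<Rightarrow> nat) \<Rightarrow> (nat \<Rightarrow> nat) \<Rightarrow> bool" where
  "agree m u v \<longleftrightarrow> (\<forall>i<m. u i = v i)"

lemma agree_mono: "agree m u v \<Longrightarrow> m' \<le> m \<Longrightarrow> agree m' u v"
  by (auto simp: agree_def)

fun prepend :: "nat list \<Rightarrow> (nat \<Rightarrow> nat) \<Rightarrow> nat \<Rightarrow> nat" where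
  "prepend [] v = v"
| "prepend (a # xs) v = (\<lambda>i. case i of 0 \<Rightarrow> a | Suc j \<Rightarrow> prepend xs v j)"

lemma prepend_Cons_0 [simp]: "prepend (a # xs) v 0 = a"
  by simp

lemma prepend_nth: "prepend xs v i = (if i < length xs then xs ! i else v (i - length xs))"
  by (induction xs arbitrary: i) (auto split: nat.splits)

lemma shift_prepend [simp]: "shift (prepend (a # xs) v) = prepend xs v"
  by (simp add: shift_def)

text \<open>Sequences are peeled by their entry at 0 and by \<open>shift\<close>; unfolding the case
  expression would block those rules.\<close>

declare prepend.simps(2) [simp del]

fun starts :: "nat list \<Rightarrow> (nat \<Rightarrow> nat) \<Rightarrow> bool" where
  "starts [] v \<longleftrightarrow> True"
| "starts (a # xs) v \<longleftrightarrow> v 0 = a \<and> starts xs (shift v)"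

lemma starts_prepend [simp]: "starts (xs @ ys) (prepend xs v) \<longleftrightarrow> starts ys v"
  by (induction xs) simp_all

text \<open>In a product of discrete spaces convergence means that each entry eventually equals its
  limit, and finitely many entries do so simultaneously.\<close>

lemma tendsto_agree:
  fixes f :: "nat \<Rightarrow> nat \<Rightarrow> nat"
  shows "f \<longlonglongrightarrow> l \<longleftrightarrow> (\<forall>m. \<exists>R. \<forall>r\<ge>R. agree m (f r) l)"
proof -
  have "f \<longlonglongrightarrow> l \<longleftrightarrow> (\<forall>i. (\<lambda>r. f r i) \<longlonglongrightarrow> l i)"
    using limitin_componentwise[of "\<lambda>_. euclidean" UNIV f l sequentially]
    by (simp add: euclidean_product_topology)
  also have "\<dots> \<longleftrightarrow> (\<forall>i. \<forall>\<^sub>F r in sequentially. f r i = l i)"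
    by (simp add: tendsto_discrete)
  also have "\<dots> \<longleftrightarrow> (\<forall>m. \<forall>\<^sub>F r in sequentially. agree m (f r) l)" (is "?L \<longleftrightarrow> ?R")
  proof
    assume ?L
    then have "\<forall>\<^sub>F r in sequentially. \<forall>i\<in>{..<m}. f r i = l i" for m
      by (intro eventually_ball_finite) simp_all
    then show ?R by (simp add: agree_def Ball_def)
  next
    assume R: ?R
    have "\<forall>\<^sub>F r in sequentially. f r i = l i" for i
      using R[rule_format, of "Suc i"] by eventually_elim (simp add: agree_def)
    then show ?L by blast
  qed
  finally show ?thesis
    by (simp add: eventually_sequentially)
qed

section \<open>Substitutions\<close>

locale digit_alphabet =
  fixes k :: nat
  assumes k2: "2 \<le> k"
begin

text \<open>Keeps \<open>k - 1\<close> from turning into \<open>k - Suc 0\<close>.\<close>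

declare One_nat_def [simp del]

abbreviation sub :: "nat \<Rightarrow> nat list \<Rightarrow> nat list" where
  "sub n xs \<equiv> concat (map (subst_digit k n) xs)"

lemma subst_digit_nonempty [simp]: "subst_digit k n i \<noteq> []"
  by (simp add: subst_digit_def)

lemma length_sub_ge: "length xs \<le> length (sub n xs)"
proof (induction xs)
  case (Cons a xs)
  have "0 < length (subst_digit k n a)" by simp
  with Cons show ?case by (simp del: length_greater_0_conv)
qed simp

lemma subst_digit_less: "i < k \<Longrightarrow> set (subst_digit k n i) \<subseteq> {..<k}"
  using k2 by (auto simp: subst_digit_def)

lemma sub_less: "set xs \<subseteq> {..<k} \<Longrightarrow> set (sub n xs) \<subseteq> {..<k}"
  using subst_digit_less by fastforce

text \<open>The recursion that replaces the truncated concatenation: images are nonempty, so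
  substituting further digits does not change entries already read.\<close>

lemma subst_seq_prepend:
  "subst_seq k n v = prepend (subst_digit k n (v 0)) (subst_seq k n (shift v))"
proof
  fix m
  let ?f = "subst_digit k n" and ?p = "\<lambda>v m. map (\<lambda>j. subst_digit k n (v j)) [0..<m]"
  have len: "m \<le> length (concat (?p u m))" for u m
    using length_sub_ge[of "map u [0..<m]" n] by (simp add: comp_def)
  have eq: "?p v (Suc m) = ?f (v 0) # ?p (shift v) m" for m
    unfolding upt_conv_Cons[OF zero_less_Suc] map_Suc_upt[symmetric]
    by (simp add: shift_def comp_def One_nat_def)
  show "subst_seq k n v m = prepend (?f (v 0)) (subst_seq k n (shift v)) m"
  proof (cases "m < length (?f (v 0))")
    case True
    then show ?thesis unfolding subst_seq_def eq by (simp add: prepend_nth nth_append)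
  next
    case False
    define d where "d = m - length (?f (v 0))"
    have "0 < length (?f (v 0))" by simp
    with False have dm: "Suc d \<le> m" unfolding d_def by linarith
    then have split: "[0..<m] = [0..<Suc d] @ [Suc d..<m]"
      by (metis le_add_diff_inverse upt_add_eq_append zero_le)
    \<comment> \<open>The images of the first d + 1 digits already have more than d letters.\<close>
    have "concat (?p (shift v) m) ! d = concat (?p (shift v) (Suc d)) ! d"
      unfolding split map_append concat_append
      using len[of "Suc d" "shift v"] by (subst nth_append) auto
    moreover have "subst_seq k n v m = concat (?p (shift v) m) ! d"
      using False unfolding subst_seq_def eq d_def by (simp add: nth_append)
    moreover have "prepend (?f (v 0)) (subst_seq k n (shift v)) m
        = concat (?p (shift v) (Suc d)) ! d"
      using False by (simp add: prepend_nth d_def subst_seq_def)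
    ultimately show ?thesis by simp
  qed
qed

lemma starts_sub: "starts xs v \<Longrightarrow> starts (sub n xs) (subst_seq k n v)"
proof (induction xs arbitrary: v)
  case (Cons a xs)
  then show ?case by (subst subst_seq_prepend) simp
qed simp

lemma subst_seq_in_seqs: "v \<in> seqs k \<Longrightarrow> subst_seq k n v \<in> seqs k"
proof -
  assume v: "v \<in> seqs k"
  have "subst_seq k n v m < k" for m
  proof -
    let ?xs = "concat (map (subst_digit k n) (map v [0..<Suc m]))"
    have "?xs ! m \<in> set ?xs"
      using length_sub_ge[of "map v [0..<Suc m]" n] by (intro nth_mem) simp
    moreover have "set ?xs \<subseteq> {..<k}"
      using v by (intro sub_less) (auto simp: seqs_def)
    ultimately show ?thesis by (auto simp: subst_seq_def comp_def)
  qed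
  then show ?thesis by (simp add: seqs_def)
qed

lemma subst_seq_0: "v 0 = k - 1 \<Longrightarrow> subst_seq k n v 0 = k - 1"
  by (subst subst_seq_prepend) (simp add: subst_digit_def)

lemma subst_seq_0_pos: "0 < subst_seq k n v 0"
  using k2 by (subst subst_seq_prepend) (simp add: subst_digit_def)

lemma agree_subst_seq: "agree m u v \<Longrightarrow> agree m (subst_seq k n u) (subst_seq k n v)"
proof -
  assume "agree m u v"
  then have "map (\<lambda>j. subst_digit k n (u j)) [0..<Suc i] = map (\<lambda>j. subst_digit k n (v j)) [0..<Suc i]"
    if "i < m" for i
    using that by (auto simp: agree_def)
  then show ?thesis unfolding agree_def subst_seq_def by metis
qed

lemma agree_prepend:
  "agree m u v \<Longrightarrow> agree (length xs + m) (prepend xs u) (prepend xs v)"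
  by (auto simp: agree_def prepend_nth)

text \<open>The common leading digit k - 1 has an image of length n + 1, which lengthens the
  agreement by n; the other digits lose nothing.\<close>

lemma agree_subst_seq_top:
  assumes "agree m u v" "1 \<le> m" "u 0 = k - 1"
  shows "agree (m + n) (subst_seq k n u) (subst_seq k n v)"
proof -
  have "agree (m - 1) (shift u) (shift v)"
    using assms by (auto simp: agree_def shift_def)
  then have "agree (length (subst_digit k n (k-1)) + (m - 1)) (subst_seq k n u) (subst_seq k n v)"
    using assms unfolding subst_seq_prepend[of n u] subst_seq_prepend[of n v]
    by (metis agree_def agree_prepend agree_subst_seq less_le_trans zero_less_one)
  then show ?thesis using assms by (simp add: subst_digit_def add.commute)
qed

lemma subst_seq_const: "subst_seq k 0 (\<lambda>_. k - 1) = (\<lambda>_. k - 1)"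
proof -
  have "concat (map (\<lambda>j. [k - 1]) xs) = map (\<lambda>j. k - 1) xs" for xs :: "nat list"
    by (induction xs) auto
  then show ?thesis by (simp add: subst_seq_def subst_digit_def del: upt_Suc)
qed

section \<open>The multidimensional continued fraction map\<close>

definition top_simplex :: "(nat \<Rightarrow> real) set" where
  "top_simplex = {\<alpha> \<in> freq_simplex k. \<alpha> (k - 1) \<noteq> 0}"

text \<open>The splittings match \<open>K_map\<close>: the first groups its values, the second its
  arguments, and the middle sums correspond under i to i + 1.\<close>

lemma sum_split_ends:
  fixes f :: "nat \<Rightarrow> 'a :: comm_monoid_add"
  shows "(\<Sum>i<k. f i) = (\<Sum>i<k-2. f i) + f (k-2) + f (k-1)"
  and "(\<Sum>i<k. f i) = f 0 + (\<Sum>i<k-2. f (i+1)) + f (k-1)"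
proof -
  obtain m where m: "k = Suc (Suc m)" using k2 by (metis Suc_le_D numeral_2_eq_2 Suc_le_mono)
  show "(\<Sum>i<k. f i) = (\<Sum>i<k-2. f i) + f (k-2) + f (k-1)"
    unfolding m by simp
  show "(\<Sum>i<k. f i) = f 0 + (\<Sum>i<k-2. f (i+1)) + f (k-1)"
    unfolding m sum.lessThan_Suc_shift[of f "Suc m"] sum.lessThan_Suc[of "\<lambda>i. f (Suc i)"]
    by (simp add: add.assoc One_nat_def)
qed

text \<open>The last two inequalities bracket the floor; they make coordinate k - 2 of
  \<open>K_map k \<alpha>\<close> nonnegative and coordinate k - 1 positive.\<close>

lemma top_simplexD:
  assumes "\<alpha> \<in> top_simplex"
  shows "0 < \<alpha> (k-1)" "0 \<le> \<alpha> i" "\<alpha> 0 < 1" "i \<ge> k \<Longrightarrow> \<alpha> i = 0" "(\<Sum>i<k. \<alpha> i) = 1"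
    "real (J_map k \<alpha>) * \<alpha> (k-1) \<le> \<alpha> 0" "\<alpha> 0 < (real (J_map k \<alpha>) + 1) * \<alpha> (k-1)"
proof -
  show nn: "0 \<le> \<alpha> i" for i
    using assms by (cases "i < k") (auto simp: top_simplex_def freq_simplex_def)
  show pos: "0 < \<alpha> (k-1)"
    using assms nn[of "k-1"] by (auto simp: top_simplex_def)
  show "i \<ge> k \<Longrightarrow> \<alpha> i = 0" and one: "(\<Sum>i<k. \<alpha> i) = 1"
    using assms by (auto simp: top_simplex_def freq_simplex_def)
  then have "\<alpha> 0 + (\<Sum>i<k-2. \<alpha> (i+1)) + \<alpha> (k-1) = 1"
    by (simp add: sum_split_ends(2))
  moreover have "0 \<le> (\<Sum>i<k-2. \<alpha> (i+1))" by (intro sum_nonneg nn)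
  ultimately show "\<alpha> 0 < 1" using pos by linarith
  have J: "real (J_map k \<alpha>) = of_int \<lfloor>\<alpha> 0 / \<alpha> (k-1)\<rfloor>"
    using nn pos by (simp add: J_map_def)
  show "real (J_map k \<alpha>) * \<alpha> (k-1) \<le> \<alpha> 0"
    unfolding J using pos by (simp flip: pos_le_divide_eq)
  show "\<alpha> 0 < (real (J_map k \<alpha>) + 1) * \<alpha> (k-1)"
    unfolding J using pos by (simp flip: pos_divide_less_eq)
qed

lemma K_map_simps:
  "i < k - 2 \<Longrightarrow> K_map k \<alpha> i = \<alpha> (i+1) / (1 - \<alpha> 0)"
  "K_map k \<alpha> (k-2) = (\<alpha> 0 - real (J_map k \<alpha>) * \<alpha> (k-1)) / (1 - \<alpha> 0)"
  "K_map k \<alpha> (k-1) = ((real (J_map k \<alpha>) + 1) * \<alpha> (k-1) - \<alpha> 0) / (1 - \<alpha> 0)"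
  "i \<ge> k \<Longrightarrow> K_map k \<alpha> i = 0"
  using k2 by (auto simp: K_map_def Let_def)

lemma K_map_top_simplex:
  assumes "\<alpha> \<in> top_simplex"
  shows "K_map k \<alpha> \<in> top_simplex"
proof -
  note D = top_simplexD[OF assms]
  have "0 \<le> K_map k \<alpha> i" if "i < k" for i
  proof -
    from that consider "i < k-2" | "i = k-2" | "i = k-1" by linarith
    then show ?thesis using D by cases (simp_all add: K_map_simps)
  qed
  moreover have "(\<Sum>i<k. K_map k \<alpha> i) = 1"
  proof -
    have "(\<Sum>i<k. K_map k \<alpha> i) = ((\<Sum>i<k-2. \<alpha> (i+1)) + (\<alpha> 0 - real (J_map k \<alpha>) * \<alpha> (k-1))
        + ((real (J_map k \<alpha>) + 1) * \<alpha> (k-1) - \<alpha> 0)) / (1 - \<alpha> 0)"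
      by (simp add: sum_split_ends(1) K_map_simps sum_divide_distrib add_divide_distrib diff_divide_distrib)
    also have "\<dots> = 1"
      using D(3,5) by (simp add: sum_split_ends(2) field_simps)
    finally show ?thesis .
  qed
  moreover have "K_map k \<alpha> (k-1) \<noteq> 0" using D by (simp add: K_map_simps)
  ultimately show ?thesis
    by (auto simp: top_simplex_def freq_simplex_def K_map_simps)
qed

lemma K_map_funpow_top_simplex: "\<alpha> \<in> top_simplex \<Longrightarrow> (K_map k ^^ r) \<alpha> \<in> top_simplex"
  by (induction r) (simp_all add: K_map_top_simplex)

text \<open>The only point all of whose partial quotients vanish, hence the exceptional case of
  \<open>level_induct\<close>.\<close>

definition corner :: "nat \<Rightarrow> real" where
  "corner = (\<lambda>i. if i = k - 1 then 1 else 0)"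

lemma corner_top_simplex: "corner \<in> top_simplex"
  using k2 by (auto simp: corner_def top_simplex_def freq_simplex_def)

lemma J_map_corner: "J_map k corner = 0"
  using k2 by (simp add: J_map_def corner_def)

lemma K_map_corner: "K_map k corner = corner"
  using k2 by (auto simp: K_map_def J_map_corner fun_eq_iff Let_def) (auto simp: corner_def)

text \<open>While the partial quotients vanish, \<open>K_map\<close> up to scaling rotates the first \<open>k - 1\<close>
  coordinates and subtracts the one leaving the front from the last coordinate.\<close>

lemma K_map_funpow_rotation:
  assumes "\<alpha> \<in> top_simplex" "\<And>r. J_map k ((K_map k ^^ r) \<alpha>) = 0"
  shows "\<exists>s>0. (\<forall>i<k-1. (K_map k ^^ r) \<alpha> i = s * \<alpha> ((i + r) mod (k-1))) \<and>
           (K_map k ^^ r) \<alpha> (k-1) = s * (\<alpha> (k-1) - (\<Sum>j<r. \<alpha> (j mod (k-1))))"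
proof (induction r)
  case 0
  show ?case by (rule exI[of _ 1]) auto
next
  case (Suc r)
  define \<gamma> where "\<gamma> = (K_map k ^^ r) \<alpha>"
  note D = top_simplexD[OF K_map_funpow_top_simplex[OF assms(1), of r], folded \<gamma>_def]
  obtain s where s: "s > 0" "\<And>i. i < k-1 \<Longrightarrow> \<gamma> i = s * \<alpha> ((i + r) mod (k-1))"
    "\<gamma> (k-1) = s * (\<alpha> (k-1) - (\<Sum>j<r. \<alpha> (j mod (k-1))))"
    using Suc unfolding \<gamma>_def by blast
  have J: "J_map k \<gamma> = 0" using assms(2) \<gamma>_def by simp
  have g0: "\<gamma> 0 = s * \<alpha> (r mod (k-1))" using s(2)[of 0] k2 by simp
  define t where "t = s / (1 - \<gamma> 0)"
  have "K_map k \<gamma> i = t * \<alpha> ((i + Suc r) mod (k-1))" if "i < k - 1" for i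
  proof (cases "i < k - 2")
    case True
    then show ?thesis using s(2)[of "i+1"] by (simp add: K_map_simps t_def One_nat_def)
  next
    case False
    with that have i: "i = k - 2" by simp
    have "(k - 2 + Suc r) mod (k-1) = r mod (k-1)"
    proof -
      have "k - 2 + Suc r = (k-1) + r" using k2 by simp
      then show ?thesis by (metis mod_add_self1)
    qed
    then show ?thesis unfolding i by (simp add: K_map_simps J g0 t_def)
  qed
  moreover have "K_map k \<gamma> (k-1) = t * (\<alpha> (k-1) - (\<Sum>j<Suc r. \<alpha> (j mod (k-1))))"
    by (simp add: K_map_simps J t_def s(3)) (simp add: g0 algebra_simps)
  moreover have "t > 0" using s D by (simp add: t_def)
  ultimately show ?case by (auto simp: \<gamma>_def)
qed

text \<open>By the rotation formula, positivity of the last coordinate keeps the partial sums of the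
  periodically repeated first k - 1 coordinates below \<open>\<alpha> (k - 1)\<close>. So each
  period contributes 0.\<close>

lemma J_map_zero_imp_corner:
  assumes "\<alpha> \<in> top_simplex" "\<And>r. J_map k ((K_map k ^^ r) \<alpha>) = 0"
  shows "\<alpha> = corner"
proof -
  note D = top_simplexD[OF assms(1)]
  define B where "B = (\<Sum>i<k-1. \<alpha> i)"
  have B: "0 \<le> B" unfolding B_def by (intro sum_nonneg D)
  have bound: "(\<Sum>j<r. \<alpha> (j mod (k-1))) < \<alpha> (k-1)" for r
    using K_map_funpow_rotation[OF assms, of r]
      top_simplexD(1)[OF K_map_funpow_top_simplex[OF assms(1), of r]]
    by (auto simp: zero_less_mult_iff)
  have cyc: "(\<Sum>j<M * (k-1). \<alpha> (j mod (k-1))) = real M * B" for M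
  proof (induction M)
    case (Suc M)
    have "(\<Sum>j<Suc M * (k-1). \<alpha> (j mod (k-1)))
      = (\<Sum>j<M * (k-1). \<alpha> (j mod (k-1))) + (\<Sum>j=M*(k-1)..<M*(k-1) + (k-1). \<alpha> (j mod (k-1)))"
      by (simp add: add.commute sum.atLeastLessThan_concat lessThan_atLeast0)
    also have "(\<Sum>j=M*(k-1)..<M*(k-1) + (k-1). \<alpha> (j mod (k-1))) = (\<Sum>j<k-1. \<alpha> j)"
      using sum.shift_bounds_nat_ivl[of "\<lambda>j. \<alpha> (j mod (k-1))" 0 "M*(k-1)" "k-1"]
      by (simp add: lessThan_atLeast0 add.commute)
    finally show ?case using Suc by (simp add: B_def algebra_simps)
  qed simp
  have "B = 0"
  proof (rule ccontr)
    assume "B \<noteq> 0"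
    with B have "B > 0" by simp
    then obtain M where "\<alpha> (k-1) < real M * B" using reals_Archimedean3 by blast
    with bound[of "M * (k-1)"] cyc[of M] show False by simp
  qed
  then have z: "\<alpha> i = 0" if "i < k-1" for i
    using that D(2) unfolding B_def by (subst (asm) sum_nonneg_eq_0_iff) auto
  have "{..<k} = insert (k-1) {..<k-1}" using k2 by auto
  then have "\<alpha> (k-1) = 1" using D(5) \<open>B = 0\<close> by (simp add: B_def)
  show ?thesis
  proof
    fix i
    consider "i < k-1" | "i = k-1" | "i \<ge> k" by linarith
    then show "\<alpha> i = corner i"
      using z \<open>\<alpha> (k-1) = 1\<close> D(4) k2 by cases (auto simp: corner_def)
  qed
qed

text \<open>The parameter \<open>m\<close> is a prefix length: one application of \<open>\<Lambda>\<^sub>n\<close> to a word starting with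
  \<open>k - 1\<close> lengthens it by at least \<open>n\<close>, and \<open>n > 0\<close> happens at some level unless the orbit
  stays at the corner.\<close>

lemma level_induct:
  assumes base: "\<And>\<alpha>. \<alpha> \<in> top_simplex \<Longrightarrow> P \<alpha> (1::nat)"
    and corner: "\<And>m. P corner m"
    and step: "\<And>\<alpha> m. \<alpha> \<in> top_simplex \<Longrightarrow> 1 \<le> m \<Longrightarrow> P (K_map k \<alpha>) m \<Longrightarrow> P \<alpha> (m + J_map k \<alpha>)"
    and mono: "\<And>\<alpha> m m'. P \<alpha> m \<Longrightarrow> m' \<le> m \<Longrightarrow> P \<alpha> m'"
    and "\<alpha> \<in> top_simplex"
  shows "P \<alpha> m"
proof -
  have "\<forall>\<alpha>\<in>top_simplex. P \<alpha> (Suc m)" for m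
  proof (induction m)
    case 0
    then show ?case using base by (simp add: One_nat_def)
  next
    case (Suc m)
    show ?case
    proof
      fix \<alpha> assume \<alpha>: "\<alpha> \<in> top_simplex"
      show "P \<alpha> (Suc (Suc m))"
      proof (cases "\<forall>r. J_map k ((K_map k ^^ r) \<alpha>) = 0")
        case True
        then show ?thesis using J_map_zero_imp_corner[OF \<alpha>] corner by simp
      next
        case False
        then obtain r where r: "J_map k ((K_map k ^^ r) \<alpha>) > 0" by auto
        \<comment> \<open>Passing from level r + 1 to level r gains a letter; the descent from r to
          0 loses none.\<close>
        have "P ((K_map k ^^ (Suc r)) \<alpha>) (Suc m)"
          using Suc K_map_funpow_top_simplex[OF \<alpha>] by blast
        then have "P ((K_map k ^^ r) \<alpha>) (Suc m + J_map k ((K_map k ^^ r) \<alpha>))"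
          using step[of "(K_map k ^^ r) \<alpha>" "Suc m"] K_map_funpow_top_simplex[OF \<alpha>] by simp
        then have "P ((K_map k ^^ r) \<alpha>) (Suc (Suc m))"
          by (rule mono) (use r in linarith)
        moreover have "P ((K_map k ^^ r) \<alpha>) (Suc (Suc m)) \<Longrightarrow> P \<alpha> (Suc (Suc m))" for r
        proof (induction r)
          case (Suc r)
          then have "P ((K_map k ^^ r) \<alpha>) (Suc (Suc m) + J_map k ((K_map k ^^ r) \<alpha>))"
            by (intro step K_map_funpow_top_simplex[OF \<alpha>]) (use Suc.prems in simp_all)
          then show ?case using Suc.IH mono le_add1 by blast
        qed simp
        ultimately show ?thesis by blast
      qed
    qed
  qed
  with assms(5) mono show ?thesis by (metis le_SucI order_refl)
qed

section \<open>The infimum sequence\<close>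

definition approximant :: "(nat \<Rightarrow> real) \<Rightarrow> nat \<Rightarrow> nat \<Rightarrow> nat" where
  "approximant \<alpha> r =
     foldr (\<lambda>j. subst_seq k (J_map k ((K_map k ^^ j) \<alpha>))) [0..<Suc r] (\<lambda>_. k - 1)"

lemma approximant_0: "approximant \<alpha> 0 = subst_seq k (J_map k \<alpha>) (\<lambda>_. k - 1)"
  by (simp add: approximant_def)

lemma approximant_Suc:
  "approximant \<alpha> (Suc r) = subst_seq k (J_map k \<alpha>) (approximant (K_map k \<alpha>) r)"
proof -
  have "[0..<Suc (Suc r)] = 0 # map Suc [0..<Suc r]"
    by (simp add: upt_conv_Cons map_Suc_upt del: upt_Suc)
  then show ?thesis
    by (simp add: approximant_def foldr_map comp_def funpow_swap1 del: upt_Suc)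
qed

lemma approximant_top: "approximant \<alpha> r 0 = k - 1"
  by (induction r arbitrary: \<alpha>) (simp_all add: approximant_0 approximant_Suc subst_seq_0)

lemma approximant_in_seqs: "approximant \<alpha> r \<in> seqs k"
proof (induction r arbitrary: \<alpha>)
  case 0
  show ?case unfolding approximant_0 using k2 by (intro subst_seq_in_seqs) (auto simp: seqs_def)
next
  case (Suc r)
  then show ?case unfolding approximant_Suc by (intro subst_seq_in_seqs)
qed

lemma approximant_corner: "approximant corner r = (\<lambda>_. k - 1)"
  by (induction r)
     (simp_all add: approximant_0 approximant_Suc J_map_corner K_map_corner subst_seq_const)

text \<open>Once m letters have stabilized for \<open>K_map k \<alpha>\<close>, the leading k - 1
  makes \<open>m + J_map k \<alpha>\<close> letters stabilize for \<alpha>.\<close>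

lemma approximant_Cauchy:
  assumes "\<alpha> \<in> top_simplex"
  shows "\<exists>R. \<forall>r\<ge>R. agree m (approximant \<alpha> r) (approximant \<alpha> R)"
proof (rule level_induct[where P = "\<lambda>\<alpha> m. \<exists>R. \<forall>r\<ge>R. agree m (approximant \<alpha> r) (approximant \<alpha> R)"])
  fix \<alpha> m
  assume "1 \<le> m"
    and "\<exists>R. \<forall>r\<ge>R. agree m (approximant (K_map k \<alpha>) r) (approximant (K_map k \<alpha>) R)"
  then obtain R where R: "\<forall>r\<ge>R. agree m (approximant (K_map k \<alpha>) r) (approximant (K_map k \<alpha>) R)"
    by blast
  have "agree (m + J_map k \<alpha>) (approximant \<alpha> r) (approximant \<alpha> (Suc R))" if "r \<ge> Suc R" for r
  proof -
    obtain r' where r': "r = Suc r'" "r' \<ge> R" using \<open>r \<ge> Suc R\<close> by (cases r) auto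
    then show ?thesis
      using R \<open>1 \<le> m\<close> by (simp add: approximant_Suc agree_subst_seq_top approximant_top)
  qed
  then show "\<exists>R. \<forall>r\<ge>R. agree (m + J_map k \<alpha>) (approximant \<alpha> r) (approximant \<alpha> R)" by blast
next
  fix \<alpha> :: "nat \<Rightarrow> real" and m m'
  assume "\<exists>R. \<forall>r\<ge>R. agree m (approximant \<alpha> r) (approximant \<alpha> R)" "m' \<le> m"
  then show "\<exists>R. \<forall>r\<ge>R. agree m' (approximant \<alpha> r) (approximant \<alpha> R)"
    using agree_mono by blast
qed (use assms in \<open>simp_all add: agree_def approximant_top approximant_corner\<close>)

text \<open>Justifies the definite description in \<open>inf_seq\<close>: the limit exists by a
  diagonal choice and is unique.\<close>

lemma approximant_tendsto_inf_seq:
  assumes "\<alpha> \<in> top_simplex"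
  shows "\<exists>R. \<forall>r\<ge>R. agree m (approximant \<alpha> r) (inf_seq k \<alpha>)"
proof -
  define P where "P v \<longleftrightarrow> (\<forall>m. \<exists>R. \<forall>r\<ge>R. agree m (approximant \<alpha> r) v)" for v
  obtain R where R: "\<And>m r. r \<ge> R m \<Longrightarrow> agree m (approximant \<alpha> r) (approximant \<alpha> (R m))"
    using approximant_Cauchy[OF assms] by metis
  \<comment> \<open>Entry i is read off at a stage where the first i + 1 letters are final.\<close>
  have "P (\<lambda>i. approximant \<alpha> (R (Suc i)) i)"
    unfolding P_def
  proof
    fix m
    have "agree m (approximant \<alpha> r) (\<lambda>i. approximant \<alpha> (R (Suc i)) i)"
      if "r \<ge> (\<Sum>i<m. R (Suc i))" for r
      unfolding agree_def
    proof (intro allI impI)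
      fix i assume "i < m"
      then have "R (Suc i) \<le> (\<Sum>i<m. R (Suc i))" by (intro member_le_sum) auto
      with that R[of "Suc i" r] show "approximant \<alpha> r i = approximant \<alpha> (R (Suc i)) i"
        by (simp add: agree_def)
    qed
    then show "\<exists>R'. \<forall>r\<ge>R'. agree m (approximant \<alpha> r) (\<lambda>i. approximant \<alpha> (R (Suc i)) i)" by blast
  qed
  moreover have "u = v" if "P u" "P v" for u v
  proof
    fix i
    obtain R1 where "\<forall>r\<ge>R1. agree (Suc i) (approximant \<alpha> r) u"
      using \<open>P u\<close> unfolding P_def by blast
    moreover obtain R2 where "\<forall>r\<ge>R2. agree (Suc i) (approximant \<alpha> r) v"
      using \<open>P v\<close> unfolding P_def by blast
    ultimately show "u i = v i" unfolding agree_def by (metis lessI max.cobounded1 max.cobounded2)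
  qed
  ultimately have "P (THE v. P v)" by (metis theI)
  moreover have "inf_seq k \<alpha> = (THE v. P v)"
    using assms
    by (simp add: inf_seq_def top_simplex_def P_def tendsto_agree approximant_def[symmetric] del: upt_Suc)
  ultimately show ?thesis by (simp add: P_def)
qed

text \<open>Substitution preserves agreement of prefixes, so it commutes with the limit of the
  approximants. This equation is what climbing the tower rests on.\<close>

lemma inf_seq_rec:
  assumes "\<alpha> \<in> top_simplex"
  shows "inf_seq k \<alpha> = subst_seq k (J_map k \<alpha>) (inf_seq k (K_map k \<alpha>))"
proof
  fix i
  obtain R1 where R1: "\<forall>r\<ge>R1. agree (Suc i) (approximant \<alpha> r) (inf_seq k \<alpha>)"
    using approximant_tendsto_inf_seq[OF assms] by blast
  obtain R2 where R2: "\<forall>r\<ge>R2. agree (Suc i) (approximant (K_map k \<alpha>) r) (inf_seq k (K_map k \<alpha>))"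
    using approximant_tendsto_inf_seq[OF K_map_top_simplex[OF assms]] by blast
  let ?r = "max R1 R2"
  have "inf_seq k \<alpha> i = approximant \<alpha> (Suc ?r) i"
    using R1 unfolding agree_def by (metis le_SucI lessI max.cobounded1)
  also have "\<dots> = subst_seq k (J_map k \<alpha>) (inf_seq k (K_map k \<alpha>)) i"
    using R2 agree_subst_seq[of "Suc i"] unfolding approximant_Suc
    by (metis agree_def lessI max.cobounded2)
  finally show "inf_seq k \<alpha> i = subst_seq k (J_map k \<alpha>) (inf_seq k (K_map k \<alpha>)) i" .
qed

lemma inf_seq_top: "inf_seq k \<alpha> 0 = k - 1" if "\<alpha> \<in> freq_simplex k"
proof (cases "\<alpha> \<in> top_simplex")
  case True
  then show ?thesis
    using approximant_tendsto_inf_seq[of \<alpha> 1] by (auto simp: agree_def approximant_top)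
next
  case False
  with that show ?thesis by (simp add: inf_seq_def top_simplex_def)
qed

lemma inf_seq_in_seqs:
  assumes "\<alpha> \<in> top_simplex"
  shows "inf_seq k \<alpha> \<in> seqs k"
  unfolding seqs_def
proof (standard, standard)
  fix i
  obtain r where "agree (Suc i) (approximant \<alpha> r) (inf_seq k \<alpha>)"
    using approximant_tendsto_inf_seq[OF assms] by blast
  then show "inf_seq k \<alpha> i < k"
    using approximant_in_seqs[of \<alpha> r] by (auto simp: agree_def seqs_def dest: spec[of _ i])
qed

lemma inf_seq_corner: "inf_seq k corner = (\<lambda>_. k - 1)"
proof
  fix i
  obtain r where "agree (Suc i) (approximant corner r) (inf_seq k corner)"
    using approximant_tendsto_inf_seq[OF corner_top_simplex] by blast
  then show "inf_seq k corner i = k - 1"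
    unfolding agree_def approximant_corner by (metis lessI)
qed

end

section \<open>Digit frequencies of sequences below \<open>w\<close>\<close>

text \<open>A proper prefix of p counts as smaller, because a suffix of a finite factor may end
  before it differs from p.\<close>

fun dict_less :: "nat list \<Rightarrow> nat list \<Rightarrow> bool" where
  "dict_less x [] \<longleftrightarrow> False"
| "dict_less [] (b # p) \<longleftrightarrow> True"
| "dict_less (a # x) (b # p) \<longleftrightarrow> a < b \<or> a = b \<and> dict_less x p"

fun suffixes_less :: "nat list \<Rightarrow> nat list \<Rightarrow> bool" where
  "suffixes_less p [] \<longleftrightarrow> True"
| "suffixes_less p (a # x) \<longleftrightarrow> dict_less (a # x) p \<and> suffixes_less p x"

lemma dict_less_append: "dict_less (xs @ x) (xs @ p) \<longleftrightarrow> dict_less x p"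
  by (induction xs) auto

text \<open>No letter is smaller than 0, so a smaller word can leave the block of zeros only by
  ending.\<close>

lemma dict_less_zeros:
  "dict_less x (replicate n 0 @ p) \<Longrightarrow>
    (\<exists>y. x = replicate n 0 @ y) \<or> (\<exists>j<n. x = replicate j 0)"
proof (induction n arbitrary: x)
  case (Suc n)
  show ?case
  proof (cases x)
    case Nil
    then have "x = replicate 0 0" by simp
    then show ?thesis by blast
  next
    case (Cons a y)
    with Suc.prems have a: "a = 0" and "dict_less y (replicate n 0 @ p)" by auto
    from Suc.IH[OF this(2)] show ?thesis
    proof
      assume "\<exists>j<n. y = replicate j 0"
      then obtain j where "j < n" "y = replicate j 0" by blast
      then have "Suc j < Suc n" "x = replicate (Suc j) 0" using Cons a by simp_all
      then show ?thesis by blast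
    qed (auto simp: Cons a)
  qed
qed simp

lemma dict_less_map:
  assumes "N < length p" "u N < p ! N" "\<And>i. i < N \<Longrightarrow> u i = p ! i"
  shows "dict_less (map u [0..<l]) p"
  using assms
proof (induction p arbitrary: u l N)
  case (Cons a p)
  show ?case
  proof (cases l)
    case (Suc l')
    have eq: "map u [0..<Suc l'] = u 0 # map (\<lambda>i. u (Suc i)) [0..<l']"
      by (simp add: upt_conv_Cons map_Suc_upt[symmetric] comp_def del: upt_Suc)
    show ?thesis
    proof (cases N)
      case 0
      then show ?thesis using Cons.prems unfolding Suc eq by simp
    next
      case (Suc N')
      then have "dict_less (map (\<lambda>i. u (Suc i)) [0..<l']) p"
        using Cons.prems(1,2) Cons.prems(3)[of "Suc _"] by (intro Cons.IH[of N']) auto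
      then show ?thesis using Cons.prems(3)[of 0] Suc unfolding \<open>l = Suc l'\<close> eq by simp
    qed
  qed simp
qed simp

lemma starts_iff: "starts p v \<longleftrightarrow> (\<forall>i<length p. v i = p ! i)"
proof (induction p arbitrary: v)
  case (Cons a p)
  then show ?case by (auto simp: shift_def less_Suc_eq_0_disj)
qed simp

lemma digit_count_Suc: "digit_count i (Suc r) v = digit_count i r v + (if v r = i then 1 else 0)"
proof -
  have "{j. j < Suc r \<and> v j = i} = {j. j < r \<and> v j = i} \<union> (if v r = i then {r} else {})"
    by (auto simp: less_Suc_eq)
  then show ?thesis unfolding digit_count_def by (auto simp: card_insert_if)
qed

lemma digit_count_0: "digit_count i 0 v = 0"
  by (simp add: digit_count_def)

lemma sum_weight_prefix:
  assumes "v \<in> seqs k"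
  shows "sum_list (map g (map v [0..<r])) = (\<Sum>i<k. g i * real (digit_count i r v))"
proof (induction r)
  case (Suc r)
  have "(\<Sum>i<k. g i * real (digit_count i (Suc r) v))
      = (\<Sum>i<k. g i * real (digit_count i r v)) + (\<Sum>i<k. if v r = i then g i else 0)"
    unfolding sum.distrib[symmetric] by (intro sum.cong) (auto simp: digit_count_Suc algebra_simps)
  also have "(\<Sum>i<k. if v r = i then g i else 0) = g (v r)"
    using assms by (simp add: seqs_def)
  finally show ?case using Suc by simp
qed (simp add: digit_count_0)

context digit_alphabet
begin

lemma k_diff_simps [simp]: "\<not> k \<le> 1" "k - 1 \<noteq> 0" "k - 2 < k - 1" "k - 2 \<noteq> k - 1" "k - 1 < k" "k - 1 \<noteq> k - 2"
  using k2 by auto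

lemma subst_digit_top [simp]: "subst_digit k n (k - 1) = (k - 1) # replicate n 0"
  by (simp add: subst_digit_def)

lemma subst_digit_low [simp]: "subst_digit k n (k - 2) = (k - 1) # 0 # replicate n 0"
  by (simp add: subst_digit_def flip: Suc_eq_plus1)

fun gaps_ge :: "nat \<Rightarrow> nat list \<Rightarrow> bool" where
  "gaps_ge n [] \<longleftrightarrow> True"
| "gaps_ge n (a # x) \<longleftrightarrow>
     (a = k - 1 \<longrightarrow> (\<exists>y. x = replicate n 0 @ y) \<or> (\<exists>j<n. x = replicate j 0)) \<and> gaps_ge n x"

text \<open>Behind a letter k - 1 the comparison continues against the n zeros, where
  \<open>dict_less_zeros\<close> applies.\<close>

lemma gaps_geI: "suffixes_less ((k - 1) # replicate n 0 @ p) x \<Longrightarrow> gaps_ge n x"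
  by (induction x) (auto dest: dict_less_zeros)

text \<open>Inverting \<open>\<Lambda>\<^sub>n\<close> on words that contain superfluous zeros: reading from the right, zeros
  are collected, each digit \<open>k - 1\<close> consumes \<open>n\<close> or \<open>n + 1\<close> of them, and the rest is carried on
  to the left. Deleting superfluous zeros on the spot would make the desubstituted word
  lexicographically larger. The \<open>n + 2\<close> zeros available at the right end ensure that the last
  \<open>k - 1\<close> becomes \<open>k - 2\<close> and leaves a surplus.\<close>

fun surplus :: "nat \<Rightarrow> nat list \<Rightarrow> nat" where
  "surplus n [] = n + 2"
| "surplus n (a # x) =
    (if a = 0 then surplus n x + 1
     else if a = k - 1 then (if surplus n x \<le> n then 0 else surplus n x - n - 1)
     else surplus n x)"

fun desubst :: "nat \<Rightarrow> nat list \<Rightarrow> nat list" where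
  "desubst n [] = []"
| "desubst n (a # x) =
    (if a = 0 then desubst n x
     else if a = k - 1 then (if surplus n x \<le> n then k - 1 else k - 2) # desubst n x
     else (a - 1) # desubst n x)"

lemma surplus_zeros [simp]: "surplus n (replicate j 0 @ x) = j + surplus n x"
  by (induction j) auto

lemma surplus_replicate [simp]: "surplus n (replicate j 0) = j + n + 2"
  using surplus_zeros[of n j "[]"] by simp

lemma desubst_zeros [simp]: "desubst n (replicate j 0 @ x) = desubst n x"
  by (induction j) auto

lemma gaps_ge_zeros [simp]: "gaps_ge n (replicate j 0 @ x) \<longleftrightarrow> gaps_ge n x"
  by (induction j) auto

lemma desubst_less: "set x \<subseteq> {..<k} \<Longrightarrow> set (desubst n x) \<subseteq> {..<k}"
  using k2 by (induction x) auto

text \<open>With surplus 0 in front, the remainder after the first image again has surplus 0,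
  possibly after skipping one zero. So t can be compared with \<open>sub n p\<close> image by
  image.\<close>

lemma dict_less_desubst:
  "gaps_ge n t \<Longrightarrow> set t \<subseteq> {..<k} \<Longrightarrow> set p \<subseteq> {..<k} \<Longrightarrow> surplus n t = 0 \<Longrightarrow>
    dict_less t (sub n p) \<Longrightarrow> dict_less (desubst n t) p"
proof (induction t arbitrary: p rule: length_induct)
  case (1 t)
  note IH = 1(1)[rule_format]
  note prems = 1(2-)
  obtain b p' where p: "p = b # p'" using prems(5) by (cases p) auto
  obtain a x where t: "t = a # x" using prems(4) by (cases t) auto
  have a: "a \<noteq> 0" "a < k" and x: "set x \<subseteq> {..<k}" "gaps_ge n x"
    using prems t by (auto split: if_splits)
  have p': "set p' \<subseteq> {..<k}" and b: "b < k" using prems p by auto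
  show ?case
  proof (cases "a = k - 1")
    case False
    have "surplus n x = 0" using prems(4) t False a by simp
    moreover have ?thesis if "dict_less (desubst n x) p'" "b = a - 1"
      using t p that a False by simp
    moreover have ?thesis if "a - 1 < b" using t p that a False by simp
    moreover have "a - 1 < b \<or> a - 1 = b \<and> dict_less x (sub n p')"
    proof (cases "b < k - 2")
      case True
      then have "subst_digit k n b = [b + 1]" by (simp add: subst_digit_def)
      then show ?thesis using prems(5) a by (auto simp: t p)
    next
      case *: False
      then show ?thesis using False a b by linarith
    qed
    ultimately show ?thesis using IH[of x p'] t x p' by auto
  next
    case True
    consider (short) j where "j < n" "x = replicate j 0" | (long) y where "x = replicate n 0 @ y"
      using prems(1) True t by auto
    then show ?thesis
    proof cases
      case short
      \<comment> \<open>The run reaches the right end, where n + 2 zeros are granted, so a surplus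
        is left over.\<close>
      then have "surplus n t = j + 1" using t True by simp
      with prems(4) show ?thesis by simp
    next
      case long
      note IHy = IH[of _ p']
      have y: "set y \<subseteq> {..<k}" "gaps_ge n y"
        using x long by simp_all
      have nb: "\<not> b < k - 2"
      proof
        assume "b < k - 2"
        then have "subst_digit k n b = [b + 1]" by (simp add: subst_digit_def)
        then have "k - 1 \<le> b + 1" using prems(5) by (auto simp: t p True)
        with \<open>b < k - 2\<close> show False by linarith
      qed
      have top: "dict_less y (sub n p')" if "b = k - 1"
        using prems(5) that by (simp add: t p True long dict_less_append)
      have low: "dict_less y (0 # sub n p')" if "b = k - 2"
      proof -
        have "sub n p = ((k - 1) # replicate n 0) @ 0 # sub n p'"
          using that by (simp add: p replicate_app_Cons_same)
        moreover have "t = ((k - 1) # replicate n 0) @ y" by (simp add: t True long)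
        ultimately show ?thesis using prems(5) dict_less_append by metis
      qed
      show ?thesis
      proof (cases "surplus n y = 0")
        case s: True
        then obtain c z where c: "y = c # z" "c \<noteq> 0" by (cases y) (auto split: if_splits)
        \<comment> \<open>For b = k - 2 the word y would have to be smaller than a word starting
          with 0, but it starts with a nonzero letter.\<close>
        then have "b = k - 1" using low nb b by fastforce
        then show ?thesis using IHy[of y] top y p' s by (simp add: t p True long)
      next
        case s: False
        then have s1: "surplus n y = 1" using prems(4) by (simp add: t True long)
        have D: "desubst n t = (k - 2) # desubst n y" using s by (simp add: t True long)
        show ?thesis
        proof (cases "b = k - 1")
          case True
          then show ?thesis by (simp add: D p)
        next
          case False
          then have b: "b = k - 2" using nb b by linarith
          \<comment> \<open>The empty word has surplus n + 2, not 1.\<close>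
          obtain c z where c: "y = c # z" using s1 by (cases y) auto
          with low[OF b] have "c = 0" "dict_less z (sub n p')" by auto
          then show ?thesis using IHy[of z] y p' s1 c b unfolding D p by (simp add: t long)
        qed
      qed
    qed
  qed
qed

text \<open>Only suffixes starting with k - 1 need an argument, and \<open>desubst\<close> writes k
  - 1 only where the surplus drops to 0, as \<open>dict_less_desubst\<close> demands.\<close>

lemma suffixes_less_desubst:
  assumes "suffixes_less (sub n ((k - 1) # p)) x" "set x \<subseteq> {..<k}" "set p \<subseteq> {..<k}"
  shows "suffixes_less ((k - 1) # p) (desubst n x)"
proof -
  have "gaps_ge n x" using assms(1) by (intro gaps_geI) (simp add: subst_digit_def)
  with assms show ?thesis
  proof (induction x)
    case (Cons a x)
    then have IH: "suffixes_less ((k - 1) # p) (desubst n x)" by simp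
    show ?case
    proof (cases "a = k - 1 \<and> surplus n x \<le> n")
      case True
      then have "surplus n (a # x) = 0" by simp
      then have "dict_less (desubst n (a # x)) ((k - 1) # p)"
        using Cons.prems by (intro dict_less_desubst) (auto simp del: desubst.simps surplus.simps)
      then show ?thesis using IH True by simp
    next
      case False
      then show ?thesis using IH Cons.prems(2) by auto
    qed
  qed simp
qed

text \<open>The row vector \<open>g\<close> with \<open>g \<cdot> M\<^sub>n = g'\<close>, where \<open>M\<^sub>n\<close> is the abelianization of
  \<open>\<Lambda>\<^sub>n\<close>.\<close>

definition pull_weight :: "nat \<Rightarrow> (nat \<Rightarrow> real) \<Rightarrow> nat \<Rightarrow> real" where
  "pull_weight n g' i =
     (if i = 0 then g' (k - 2) - g' (k - 1)
      else if i = k - 1 then (real n + 1) * g' (k - 1) - real n * g' (k - 2)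
      else g' (i - 1))"

text \<open>The image of a digit i has pulled-back weight \<open>g' i\<close>, so only the
  unconsumed zeros remain to be weighed, less the n + 2 granted at the right end.\<close>

lemma sum_pull_weight_le:
  assumes "g' (k - 2) \<le> g' (k - 1)" "gaps_ge n x"
  shows "sum_list (map (pull_weight n g') x) \<le> sum_list (map g' (desubst n x)) +
    (real (surplus n x) - real (n + 2)) * pull_weight n g' 0"
  using assms(2)
proof (induction x)
  case (Cons a x)
  define d where "d = g' (k - 2) - g' (k - 1)"
  have d: "d \<le> 0" "pull_weight n g' 0 = d" using assms(1) by (simp_all add: d_def pull_weight_def)
  have IH: "sum_list (map (pull_weight n g') x) \<le> sum_list (map g' (desubst n x)) +
    (real (surplus n x) - real (n + 2)) * d"
    using Cons d by simp
  consider "a = 0" | "a \<noteq> 0" "a \<noteq> k - 1" | "a = k - 1" "surplus n x \<le> n"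
    | "a = k - 1" "surplus n x > n" by linarith
  then show ?case
  proof cases
    case 1
    then show ?thesis using IH by (simp add: d algebra_simps)
  next
    case 2
    then show ?thesis using IH by (simp add: d) (simp add: pull_weight_def)
  next
    case 3
    \<comment> \<open>Either n zeros follow the k - 1, or the run ends at the granted zeros.\<close>
    have "surplus n x \<ge> n" using Cons.prems 3 by auto
    then have s: "surplus n x = n" using 3 by simp
    have "pull_weight n g' a = g' (k - 1) - real n * d"
      using 3 by (simp add: pull_weight_def d_def algebra_simps)
    then show ?thesis using IH 3 s by (simp add: d algebra_simps)
  next
    case 4
    then have "real (surplus n (a # x)) - real (n + 2) = (real (surplus n x) - real (n + 2)) - (real n + 1)"
      by simp
    then have "(real (surplus n (a # x)) - real (n + 2)) * d
        = (real (surplus n x) - real (n + 2)) * d - (real n + 1) * d"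
      by (simp only: left_diff_distrib)
    moreover have "pull_weight n g' a = g' (k - 2) - (real n + 1) * d"
      using 4 by (simp add: pull_weight_def d_def algebra_simps)
    moreover have "desubst n (a # x) = (k - 2) # desubst n x" using 4 by simp
    ultimately show ?thesis using IH unfolding d by (simp del: surplus.simps desubst.simps)
  qed
qed simp

text \<open>\<alpha> is \<open>1 - \<alpha> 0\<close> times the image of
  \<open>K_map k \<alpha>\<close> under the abelianization, to which \<open>pull_weight\<close> is
  adjoint.\<close>

lemma pull_weight_dot:
  assumes "\<alpha> \<in> top_simplex"
  shows "(\<Sum>i<k. pull_weight (J_map k \<alpha>) g' i * \<alpha> i) = (1 - \<alpha> 0) * (\<Sum>i<k. g' i * K_map k \<alpha> i)"
proof -
  have "1 - \<alpha> 0 \<noteq> 0" using top_simplexD(3)[OF assms] by simp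
  then have K: "(1 - \<alpha> 0) * K_map k \<alpha> (k-2) = \<alpha> 0 - real (J_map k \<alpha>) * \<alpha> (k-1)"
    "(1 - \<alpha> 0) * K_map k \<alpha> (k-1) = (real (J_map k \<alpha>) + 1) * \<alpha> (k-1) - \<alpha> 0"
    "\<And>i. i < k - 2 \<Longrightarrow> (1 - \<alpha> 0) * K_map k \<alpha> i = \<alpha> (i+1)"
    by (simp_all add: K_map_simps)
  have "(\<Sum>i<k-2. pull_weight (J_map k \<alpha>) g' (i+1) * \<alpha> (i+1))
      = (\<Sum>i<k-2. g' i * ((1 - \<alpha> 0) * K_map k \<alpha> i))"
    by (intro sum.cong refl) (use K(3) in \<open>auto simp: pull_weight_def\<close>)
  then have S: "(\<Sum>i<k-2. pull_weight (J_map k \<alpha>) g' (i+1) * \<alpha> (i+1))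
      = (1 - \<alpha> 0) * (\<Sum>i<k-2. g' i * K_map k \<alpha> i)"
    by (simp add: sum_distrib_left algebra_simps)
  have "(1 - \<alpha> 0) * (\<Sum>i<k. g' i * K_map k \<alpha> i)
    = (1 - \<alpha> 0) * (\<Sum>i<k-2. g' i * K_map k \<alpha> i) + g' (k-2) * ((1 - \<alpha> 0) * K_map k \<alpha> (k-2))
       + g' (k-1) * ((1 - \<alpha> 0) * K_map k \<alpha> (k-1))"
    unfolding sum_split_ends(1) by (simp add: algebra_simps)
  also have "\<dots> = (\<Sum>i<k. pull_weight (J_map k \<alpha>) g' i * \<alpha> i)"
    unfolding sum_split_ends(2) K(1,2) S by (simp add: pull_weight_def algebra_simps)
  finally show ?thesis by simp
qed

section \<open>Functionals separating \<alpha> from the sequences below I(\<alpha>)\<close>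

definition bounded_weight :: "nat list \<Rightarrow> (nat \<Rightarrow> real) \<Rightarrow> bool" where
  "bounded_weight p g \<longleftrightarrow>
     (\<exists>C. \<forall>x. set x \<subseteq> {..<k} \<and> suffixes_less p x \<longrightarrow> sum_list (map g x) \<le> C)"

lemma bounded_weight_sub:
  assumes "bounded_weight ((k - 1) # p) g'" "set p \<subseteq> {..<k}" "g' (k - 2) \<le> g' (k - 1)"
  shows "bounded_weight (sub n ((k - 1) # p)) (pull_weight n g')"
proof -
  obtain C where C: "\<And>x. set x \<subseteq> {..<k} \<Longrightarrow> suffixes_less ((k - 1) # p) x \<Longrightarrow> sum_list (map g' x) \<le> C"
    using assms(1) unfolding bounded_weight_def by blast
  define e where "e = pull_weight n g' 0"
  have e: "e \<le> 0" using assms(3) by (simp add: e_def pull_weight_def)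
  have "sum_list (map (pull_weight n g') x) \<le> C - real (n + 2) * e"
    if "set x \<subseteq> {..<k}" "suffixes_less (sub n ((k - 1) # p)) x" for x
  proof -
    have "gaps_ge n x" using that(2) by (intro gaps_geI) (simp add: subst_digit_def)
    from sum_pull_weight_le[OF assms(3) this]
    have "sum_list (map (pull_weight n g') x)
      \<le> sum_list (map g' (desubst n x)) + (real (surplus n x) * e - real (n + 2) * e)"
      by (simp add: e_def left_diff_distrib)
    moreover have "sum_list (map g' (desubst n x)) \<le> C"
      using that assms(2) by (intro C desubst_less suffixes_less_desubst)
    moreover have "real (surplus n x) * e \<le> 0" using e by (simp add: mult_nonneg_nonpos)
    ultimately show ?thesis by linarith
  qed
  then show ?thesis unfolding bounded_weight_def by blast
qed

text \<open>Runs of k - 1 have length at most j, and the digit in front of a run pays for it with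
  weight -j. Only the leading run remains unpaid.\<close>

lemma bounded_weight_replicate:
  "bounded_weight (replicate (Suc j) (k - 1)) (\<lambda>i. if i = k - 1 then 1 else - real j)"
proof -
  let ?g = "\<lambda>i. if i = k - 1 then 1 else - real j"
  let ?lead = "\<lambda>x. length (takeWhile (\<lambda>a. a = k - 1) x)"
  have lead: "?lead x < l" if "dict_less x (replicate l (k - 1))" for x l
    using that
  proof (induction l arbitrary: x)
    case (Suc l)
    then show ?case by (cases x) auto
  qed simp
  have "sum_list (map ?g x) \<le> real (?lead x) \<and> ?lead x \<le> j"
    if "suffixes_less (replicate (Suc j) (k - 1)) x" for x
    using that
  proof (induction x)
    case (Cons a x)
    then have "?lead (a # x) < Suc j" by (intro lead) simp
    moreover have "sum_list (map ?g x) \<le> real (?lead x)" "?lead x \<le> j"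
      using Cons by simp_all
    ultimately show ?case by auto
  qed simp
  then show ?thesis unfolding bounded_weight_def by (intro exI[of _ "real j"]) force
qed

text \<open>A certificate against frequency \<alpha>: g has bounded sums below the prefix but
  positive mean under \<alpha>. The signs give \<open>g (k - 2) \<le> g (k - 1)\<close>, which
  pulling back requires, and they survive it.\<close>

definition separated :: "(nat \<Rightarrow> real) \<Rightarrow> nat \<Rightarrow> bool" where
  "separated \<alpha> m \<longleftrightarrow> (\<exists>p g. m \<le> Suc (length p) \<and> starts ((k - 1) # p) (inf_seq k \<alpha>) \<and>
     set p \<subseteq> {..<k} \<and> (\<forall>i<k-1. g i \<le> 0) \<and> 0 < g (k - 1) \<and>
     bounded_weight ((k - 1) # p) g \<and> 0 < (\<Sum>i<k. g i * \<alpha> i))"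

lemma separated_step:
  assumes "\<alpha> \<in> top_simplex" "separated (K_map k \<alpha>) m"
  shows "separated \<alpha> (m + J_map k \<alpha>)"
proof -
  let ?n = "J_map k \<alpha>"
  obtain p g where pg: "m \<le> Suc (length p)" "starts ((k - 1) # p) (inf_seq k (K_map k \<alpha>))"
     "set p \<subseteq> {..<k}" "\<forall>i<k-1. g i \<le> 0" "0 < g (k - 1)"
     "bounded_weight ((k - 1) # p) g" "0 < (\<Sum>i<k. g i * K_map k \<alpha> i)"
    using assms(2) unfolding separated_def by blast
  have g2: "g (k - 2) \<le> 0" using pg(4) by simp
  have eq: "sub ?n ((k - 1) # p) = (k - 1) # (replicate ?n 0 @ sub ?n p)"
    by (simp add: subst_digit_def)
  show ?thesis
    unfolding separated_def
  proof (intro exI conjI)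
    show "m + ?n \<le> Suc (length (replicate ?n 0 @ sub ?n p))"
      using pg(1) length_sub_ge[of p ?n] by simp
    show "starts ((k - 1) # (replicate ?n 0 @ sub ?n p)) (inf_seq k \<alpha>)"
      unfolding eq[symmetric] inf_seq_rec[OF assms(1)] using pg(2) by (rule starts_sub)
    show "set (replicate ?n 0 @ sub ?n p) \<subseteq> {..<k}"
      using sub_less[OF pg(3)] k2 by auto
    show "bounded_weight ((k - 1) # (replicate ?n 0 @ sub ?n p)) (pull_weight ?n g)"
      unfolding eq[symmetric] by (intro bounded_weight_sub pg(3,6)) (use pg(5) g2 in linarith)
    show "0 < (\<Sum>i<k. pull_weight ?n g i * \<alpha> i)"
      using pg(7) top_simplexD(3)[OF assms(1)] by (simp add: pull_weight_dot[OF assms(1)])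
    show "\<forall>i<k-1. pull_weight ?n g i \<le> 0"
      using pg(4,5) le_less_trans[OF g2 pg(5)] by (auto simp: pull_weight_def)
    have "0 < (real ?n + 1) * g (k - 1)" using pg(5) by simp
    moreover have "real ?n * g (k - 2) \<le> 0" using g2 by (simp add: mult_nonneg_nonpos)
    ultimately have "0 < (real ?n + 1) * g (k - 1) - real ?n * g (k - 2)" by linarith
    then show "0 < pull_weight ?n g (k - 1)" by (simp add: pull_weight_def)
  qed
qed

lemma starts_const: "starts (replicate j a) (\<lambda>_. a)"
  by (simp add: starts_iff)

lemma separated:
  assumes "\<alpha> \<in> top_simplex"
  shows "separated \<alpha> m"
proof (rule level_induct[where P = separated])
  fix \<alpha> assume \<alpha>: "\<alpha> \<in> top_simplex"
  have "(\<Sum>i<k. (if i = k - 1 then 1 else 0) * \<alpha> i) = \<alpha> (k - 1)"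
    unfolding sum_split_ends(1) by (auto intro!: sum.neutral)
  \<comment> \<open>Words whose suffixes are all below the single letter k - 1 do not contain it, so
    its indicator has bounded sums.\<close>
  then show "separated \<alpha> 1"
    unfolding separated_def
    using inf_seq_top[of \<alpha>] \<alpha> top_simplexD(1)[OF \<alpha>] bounded_weight_replicate[of 0, unfolded of_nat_0 minus_zero]
    by (intro exI[of _ "[]"] exI[of _ "\<lambda>i. if i = k - 1 then 1 else 0"])
       (auto simp: top_simplex_def)
next
  fix m
  have "(\<Sum>i<k. (if i = k - 1 then 1 else - real m) * corner i) = 1"
    unfolding sum_split_ends(1) by (auto simp: corner_def intro!: sum.neutral)
  then show "separated corner m"
    unfolding separated_def
    using bounded_weight_replicate[of m]
    by (intro exI[of _ "replicate m (k - 1)"] exI[of _ "\<lambda>i. if i = k - 1 then 1 else - real m"])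
       (auto simp: inf_seq_corner starts_const shift_def)
next
  fix \<alpha> m m' assume "separated \<alpha> m" "m' \<le> m"
  then show "separated \<alpha> m'" unfolding separated_def by (meson le_trans)
qed (use assms separated_step in auto)

theorem inf_seq_le_if_subseq_freq:
  assumes w0: "w 0 = k - 1" and v: "v \<in> beta_shift k w"
    and \<alpha>: "\<alpha> \<in> freq_simplex k" and freq: "has_subseq_freq k v \<alpha>"
  shows "inf_seq k \<alpha> \<preceq> w"
proof (rule ccontr)
  assume "\<not> inf_seq k \<alpha> \<preceq> w"
  then have "less_fun w (inf_seq k \<alpha>)" using lex_linear by blast
  then obtain N where N: "w N < inf_seq k \<alpha> N" "\<And>i. i < N \<Longrightarrow> w i = inf_seq k \<alpha> i"
    by (auto elim: less_funE)
  \<comment> \<open>Otherwise I(\<alpha>) is k - 1 followed by zeros, and no \<open>w\<close> with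
    first digit k - 1 is smaller.\<close>
  have top: "\<alpha> \<in> top_simplex"
  proof (rule ccontr)
    assume "\<alpha> \<notin> top_simplex"
    then have "inf_seq k \<alpha> = (\<lambda>m. if m = 0 then k - 1 else 0)"
      using \<alpha> by (simp add: inf_seq_def top_simplex_def)
    then show False using N w0 by (auto split: if_splits)
  qed
  \<comment> \<open>Length N + 1 makes the prefix reach the first difference of \<open>w\<close> and
    I(\<alpha>).\<close>
  obtain p g where pg: "Suc N \<le> length p" "starts p (inf_seq k \<alpha>)"
     "bounded_weight p g" "0 < (\<Sum>i<k. g i * \<alpha> i)"
    using separated[OF top, of "Suc N"] unfolding separated_def by (metis length_Cons)
  obtain C where C: "\<And>x. set x \<subseteq> {..<k} \<Longrightarrow> suffixes_less p x \<Longrightarrow> sum_list (map g x) \<le> C"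
    using pg(3) unfolding bounded_weight_def by blast
  have p_nth: "p ! i = inf_seq k \<alpha> i" if "i \<le> N" for i
    using pg(1,2) that by (simp add: starts_iff)
  have vk: "v \<in> seqs k" and vw: "\<And>r. (shift ^^ r) v \<preceq> w"
    using v by (auto simp: beta_shift_def)
  have below: "dict_less (map u [0..<l]) p" if uw: "u \<preceq> w" for u l
  proof -
    have "\<exists>M\<le>N. u M < inf_seq k \<alpha> M \<and> (\<forall>i<M. u i = inf_seq k \<alpha> i)"
    proof (cases "u = w")
      case True
      then show ?thesis using N by blast
    next
      case False
      then obtain M where M: "u M < w M" "\<And>i. i < M \<Longrightarrow> u i = w i"
        using uw by (auto simp: lex_le_def elim: less_funE)
      then show ?thesis using N
        by (intro exI[of _ "min M N"]) (auto simp: min_def not_le intro: less_trans; metis less_trans le_neq_implies_less)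
    qed
    then obtain M where "M \<le> N" "u M < inf_seq k \<alpha> M" "\<And>i. i < M \<Longrightarrow> u i = inf_seq k \<alpha> i"
      by blast
    then show ?thesis using pg(1) p_nth by (intro dict_less_map[of M]) auto
  qed
  have suff: "suffixes_less p (map v [r..<r + l])" for r l
  proof (induction l arbitrary: r)
    case (Suc l)
    have eq: "map v [r..<r + Suc l] = v r # map v [Suc r..<Suc r + l]"
      by (simp add: upt_conv_Cons del: upt_Suc)
    have "map v [r..<r + Suc l] = map ((shift ^^ r) v) [0..<Suc l]"
      by (rule nth_equalityI) (auto simp: shift_funpow add.commute simp del: upt_Suc)
    then have "dict_less (map v [r..<r + Suc l]) p" using below vw by metis
    then show ?case using Suc[of "Suc r"] unfolding eq by simp
  qed simp
  \<comment> \<open>C does not depend on r, so along any subsequence the limiting mean of g is at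
    most 0.\<close>
  have bound: "(\<Sum>i<k. g i * real (digit_count i r v)) \<le> C" for r
    unfolding sum_weight_prefix[OF vk, symmetric]
    using suff[of 0 r] vk by (intro C) (auto simp: seqs_def)
  obtain \<rho> :: "nat \<Rightarrow> nat" where \<rho>: "filterlim \<rho> at_top sequentially"
    "\<And>i. i < k \<Longrightarrow> (\<lambda>s. real (digit_count i (\<rho> s) v) / real (\<rho> s)) \<longlonglongrightarrow> \<alpha> i"
    using freq unfolding has_subseq_freq_def by blast
  have "(\<lambda>s. \<Sum>i<k. g i * (real (digit_count i (\<rho> s) v) / real (\<rho> s))) \<longlonglongrightarrow> (\<Sum>i<k. g i * \<alpha> i)"
    using \<rho>(2) by (intro tendsto_sum tendsto_mult tendsto_const) auto
  moreover have "(\<lambda>s. C / real (\<rho> s)) \<longlonglongrightarrow> 0"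
    using filterlim_compose[OF filterlim_real_sequentially \<rho>(1)]
    by (intro real_tendsto_divide_at_top[OF tendsto_const])
  moreover have "(\<Sum>i<k. g i * (real (digit_count i (\<rho> s) v) / real (\<rho> s))) \<le> C / real (\<rho> s)"
    if "\<rho> s > 0" for s
    using divide_right_mono[OF bound[of "\<rho> s"], of "real (\<rho> s)"]
    by (simp add: sum_divide_distrib)
  moreover have "\<forall>\<^sub>F s in sequentially. \<rho> s > 0"
    by (rule eventually_compose_filterlim[OF eventually_gt_at_top \<rho>(1)])
  ultimately have "(\<Sum>i<k. g i * \<alpha> i) \<le> 0"
    by (intro tendsto_le[OF sequentially_bot, of "\<lambda>s. C / real (\<rho> s)" 0
        "\<lambda>s. \<Sum>i<k. g i * (real (digit_count i (\<rho> s) v) / real (\<rho> s))"])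
       (auto elim: eventually_mono)
  with pg(4) show False by simp
qed

end

section \<open>Realizing digit frequencies below \<open>\<I>(\<alpha>)\<close>\<close>

text \<open>Unlike in \<open>dict_less\<close>, running out of letters is not smaller: the
  difference lies inside the word, so every continuation stays below w.\<close>

fun strictly_below :: "nat list \<Rightarrow> (nat \<Rightarrow> nat) \<Rightarrow> bool" where
  "strictly_below [] w \<longleftrightarrow> False"
| "strictly_below (a # x) w \<longleftrightarrow> a < w 0 \<or> a = w 0 \<and> strictly_below x (shift w)"

fun good :: "(nat \<Rightarrow> nat) \<Rightarrow> nat list \<Rightarrow> bool" where
  "good w [] \<longleftrightarrow> True"
| "good w (a # x) \<longleftrightarrow> strictly_below (a # x) w \<and> good w x"

lemma strictly_below_append: "strictly_below x w \<Longrightarrow> strictly_below (x @ y) w"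
  by (induction x arbitrary: w) auto

lemma good_append: "good w x \<Longrightarrow> good w y \<Longrightarrow> good w (x @ y)"
  by (induction x) (auto intro: strictly_below_append)

lemma good_concat_replicate: "good w x \<Longrightarrow> good w (concat (replicate n x))"
  by (induction n) (auto intro: good_append)

lemma good_small: "set x \<subseteq> {..<w 0} \<Longrightarrow> good w x"
  by (induction x) auto

lemma strictly_below_prepend [simp]:
  "strictly_below (xs @ x) (prepend xs w) \<longleftrightarrow> strictly_below x w"
  by (induction xs) auto

lemma good_drop: "good w x \<Longrightarrow> r < length x \<Longrightarrow> strictly_below (drop r x) w"
proof (induction x arbitrary: r)
  case (Cons a x)
  then show ?case by (cases r) auto
qed simp

lemma less_fun_Suc: "u 0 = w 0 \<Longrightarrow> less_fun (shift u) (shift w) \<Longrightarrow> less_fun u w"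
  for u w :: "nat \<Rightarrow> nat"
proof -
  assume "u 0 = w 0" "less_fun (shift u) (shift w)"
  then obtain j where "u (Suc j) < w (Suc j)" "\<And>i. i < j \<Longrightarrow> u (Suc i) = w (Suc i)"
    by (auto simp: shift_def elim: less_funE)
  then show ?thesis
    using \<open>u 0 = w 0\<close> by (intro less_funI exI[of _ "Suc j"]) (auto simp: less_Suc_eq_0_disj)
qed

lemma strictly_below_less_fun: "strictly_below x w \<Longrightarrow> starts x u \<Longrightarrow> less_fun u w"
proof (induction x arbitrary: u w)
  case (Cons a x)
  then show ?case using less_fun_Suc[of u w] by (auto simp: less_fun_def)
qed simp

lemma digit_count_eq_count_list: "digit_count i r v = count_list (map v [0..<r]) i"
  by (induction r) (auto simp: digit_count_0 digit_count_Suc)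

section \<open>Concatenating good words to a prescribed frequency\<close>

definition deviation :: "(nat \<Rightarrow> real) \<Rightarrow> nat \<Rightarrow> nat list \<Rightarrow> real" where
  "deviation \<alpha> i x = \<bar>real (count_list x i) - \<alpha> i * real (length x)\<bar>"

lemma deviation_append: "deviation \<alpha> i (x @ y) \<le> deviation \<alpha> i x + deviation \<alpha> i y"
  by (simp add: deviation_def algebra_simps)

lemma deviation_le_length:
  assumes "0 \<le> \<alpha> i" "\<alpha> i \<le> 1"
  shows "deviation \<alpha> i x \<le> real (length x)"
proof -
  have "\<alpha> i * real (length x) \<le> real (length x)" "0 \<le> \<alpha> i * real (length x)"
    using assms by (simp_all add: mult_left_le_one_le)
  moreover have "real (count_list x i) \<le> real (length x)" using count_le_length by simp
  ultimately show ?thesis unfolding deviation_def by linarith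
qed

text \<open>Complete copies cost e per letter; the one truncated copy costs at most its
  length.\<close>

lemma deviation_take_concat:
  assumes \<alpha>: "0 \<le> \<alpha> i" "\<alpha> i \<le> 1" and x: "deviation \<alpha> i x \<le> e * real (length x)" "0 \<le> e"
    and "m \<le> N * length x"
  shows "deviation \<alpha> i (take m (concat (replicate N x))) \<le> e * real m + real (length x)"
  using assms(5)
proof (induction N arbitrary: m)
  case 0
  then show ?case by (simp add: deviation_def)
next
  case (Suc N)
  show ?case
  proof (cases "m \<le> length x")
    case True
    then have "deviation \<alpha> i (take m (concat (replicate (Suc N) x))) \<le> real m"
      using deviation_le_length[of \<alpha> i "take m x", OF \<alpha>] by simp
    moreover have "0 \<le> e * real m" using x by simp
    ultimately show ?thesis using True by linarith
  next
    case False
    then have "deviation \<alpha> i (take m (concat (replicate (Suc N) x)))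
        \<le> deviation \<alpha> i x + deviation \<alpha> i (take (m - length x) (concat (replicate N x)))"
      using deviation_append[of \<alpha> i x] by simp
    also have "\<dots> \<le> e * real (length x) + (e * real (m - length x) + real (length x))"
      using Suc.prems by (intro add_mono x Suc.IH) simp
    also have "\<dots> = e * real m + real (length x)"
      using False by (simp add: of_nat_diff algebra_simps)
    finally show ?thesis .
  qed
qed

lemma exists_sandwich:
  fixes f :: "nat \<Rightarrow> nat"
  assumes "f s \<le> l" "\<And>s. f s < f (Suc s)"
  shows "\<exists>t\<ge>s. f t \<le> l \<and> l \<le> f (Suc t)"
proof -
  have ge: "t \<le> f t" for t
    using assms(2) by (intro strict_mono_imp_increasing strict_monoI_Suc)
  define u where "u = (LEAST u. l < f u)"
  have u: "l < f u" unfolding u_def using ge[of "Suc l"] by (intro LeastI[of "\<lambda>u. l < f u" "Suc l"]) simp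
  have mono: "a \<le> b \<Longrightarrow> f a \<le> f b" for a b
    using lift_Suc_mono_le[of f a b] assms(2) by (simp add: less_imp_le)
  have "s < u" using mono[of u s] u assms(1) by (meson leD leI le_trans)
  then obtain t where t: "u = Suc t" "s \<le> t" by (cases u) auto
  have "\<not> l < f t" using not_less_Least[of t "\<lambda>u. l < f u"] t unfolding u_def by simp
  then show ?thesis using t u by (intro exI[of _ t]) auto
qed

context digit_alphabet
begin

text \<open>Stage s appends many copies of an increasingly accurate word \<open>U s\<close>: enough
  to outweigh the past and to make the next word short in comparison.\<close>

lemma good_concatenation:
  assumes \<alpha>: "\<And>i. 0 \<le> \<alpha> i" "\<And>i. \<alpha> i \<le> 1"
    and ex: "\<And>\<epsilon>. 0 < \<epsilon> \<Longrightarrow> \<exists>U. U \<noteq> [] \<and> set U \<subseteq> {..<k} \<and> good w U \<and>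
       (\<forall>i<k. deviation \<alpha> i U \<le> \<epsilon> * real (length U))"
  shows "\<exists>v\<in>seqs k. (\<forall>r. less_fun ((shift ^^ r) v) w) \<and> has_freq k v \<alpha>"
proof -
  \<comment> \<open>Since \<open>e s / 2 \<le> e (Suc s)\<close>, two errors of
    \<open>e s / 4\<close> each meet the invariant of the next stage.\<close>
  define e where "e s = 1 / real (Suc s)" for s
  have e: "0 < e s" "e s \<le> 1" "e s / 2 \<le> e (Suc s)" for s
    by (auto simp: e_def field_simps)
  have e_mono: "e t \<le> e s" if "s \<le> t" for s t
    using that by (simp add: e_def frac_le)
  have "\<exists>U. U \<noteq> [] \<and> set U \<subseteq> {..<k} \<and> good w U \<and> (\<forall>i<k. deviation \<alpha> i U \<le> e s / 4 * real (length U))" for s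
    using ex[of "e s / 4"] e by simp
  then obtain U where U: "\<And>s. U s \<noteq> []" "\<And>s. set (U s) \<subseteq> {..<k}" "\<And>s. good w (U s)"
    "\<And>s i. i < k \<Longrightarrow> deviation \<alpha> i (U s) \<le> e s / 4 * real (length (U s))"
    by metis
  \<comment> \<open>The last clause makes a cut inside a copy of \<open>U s\<close> cheap relative
    to P.\<close>
  define Inv where "Inv s P \<longleftrightarrow> P \<noteq> [] \<and> set P \<subseteq> {..<k} \<and> good w P \<and>
    (\<forall>i<k. deviation \<alpha> i P \<le> e s * real (length P)) \<and> real (length (U s)) \<le> e s * real (length P)" for s P
  define Q where "Q s P P' \<longleftrightarrow> (\<exists>z. z \<noteq> [] \<and> P' = P @ z) \<and>
    (\<forall>l i. i < k \<longrightarrow> length P \<le> l \<longrightarrow> l \<le> length P' \<longrightarrow> deviation \<alpha> i (take l P') \<le> 3 * e s * real l)"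
    for s P P'
  have "\<exists>P. \<forall>s. Inv s (P s) \<and> Q s (P s) (P (Suc s))"
  proof (rule dependent_nat_choice)
    \<comment> \<open>\<open>e 0 = 1\<close> makes both bounds trivial.\<close>
    have "Inv 0 (U 0)"
      unfolding Inv_def using U[of 0] deviation_le_length[of \<alpha>, OF \<alpha>] by (auto simp: e_def)
    then show "\<exists>P. Inv 0 P" by blast
  next
    fix P s assume P: "Inv s P"
    let ?L = "real (length P)" and ?u = "real (length (U s))"
    have u: "1 \<le> ?u" using U(1)[of s] by (cases "U s") auto
    \<comment> \<open>The first summand lets the copies outweigh P, the second makes
      \<open>U (Suc s)\<close> short relative to the result, and 1 keeps the addition
      nonempty.\<close>
    obtain N where N: "4 * ?L / e s + real (length (U (Suc s))) / e (Suc s) + 1 \<le> real N"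
      using real_arch_simple by blast
    have pos: "0 \<le> 4 * ?L / e s" "0 \<le> real (length (U (Suc s))) / e (Suc s)"
      using e by (simp_all add: less_imp_le)
    have N1: "1 \<le> N" using N pos by linarith
    have N2: "?L \<le> real N * (e s / 4)"
    proof -
      have "4 * ?L / e s \<le> real N" using N pos by linarith
      then show ?thesis using e(1)[of s] by (simp add: field_simps)
    qed
    have N3: "real (length (U (Suc s))) \<le> e (Suc s) * real N"
    proof -
      have "real (length (U (Suc s))) / e (Suc s) \<le> real N" using N pos by linarith
      then show ?thesis using e(1)[of "Suc s"] by (simp add: field_simps)
    qed
    define z where "z = concat (replicate N (U s))"
    have lz: "length z = N * length (U s)"
      by (simp add: z_def length_concat sum_list_replicate)
    have lz1: "real N \<le> real (length z)" using u by (simp add: lz mult_le_cancel_left1)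
    have dz: "deviation \<alpha> i (take m z) \<le> e s / 4 * real m + ?u" if "i < k" "m \<le> length z" for i m
      unfolding z_def
      using that U(4)[of i s] e(1)[of s] \<alpha> lz by (intro deviation_take_concat) auto
    have dzf: "deviation \<alpha> i z \<le> e s / 4 * real (length z)" if "i < k" for i
      unfolding z_def
    proof (induction N)
      case (Suc N)
      then show ?case
        using deviation_append[of \<alpha> i "U s" "concat (replicate N (U s))"] U(4)[OF that, of s]
        by (simp add: algebra_simps)
    qed (simp add: deviation_def)
    have "Inv (Suc s) (P @ z)"
      unfolding Inv_def
    proof (intro conjI allI impI)
      show "P @ z \<noteq> []" "set (P @ z) \<subseteq> {..<k}" "good w (P @ z)"
        using P U[of s] unfolding Inv_def z_def by (auto intro!: good_append good_concat_replicate)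
      have "e (Suc s) * real N \<le> e (Suc s) * real (length (P @ z))"
        using lz1 e(1)[of "Suc s"] by (intro mult_left_mono) auto
      with N3 show "real (length (U (Suc s))) \<le> e (Suc s) * real (length (P @ z))" by linarith
      fix i assume "i < k"
      have "deviation \<alpha> i (P @ z) \<le> ?L + e s / 4 * real (length z)"
        using deviation_append[of \<alpha> i P z] deviation_le_length[of \<alpha> i P, OF \<alpha>] dzf[OF \<open>i < k\<close>]
        by linarith
      also have "?L \<le> e s / 4 * real (length z)"
        using N2 lz1 e(1)[of s] by (smt (verit) divide_pos_pos mult.commute mult_left_mono)
      also have "e s / 4 * real (length z) + e s / 4 * real (length z) = e s / 2 * real (length z)"
        by simp
      also have "\<dots> \<le> e (Suc s) * real (length (P @ z))"
        using e(1)[of s] e(3)[of s] by (intro mult_mono) auto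
      finally show "deviation \<alpha> i (P @ z) \<le> e (Suc s) * real (length (P @ z))" by simp
    qed
    moreover have "Q s P (P @ z)"
      unfolding Q_def
    proof (intro conjI allI impI)
      show "\<exists>z'. z' \<noteq> [] \<and> P @ z = P @ z'"
        using N1 lz1 by (intro exI[of _ z]) auto
      fix l i assume l: "i < k" "length P \<le> l" "l \<le> length (P @ z)"
      have "deviation \<alpha> i (take l (P @ z)) \<le> deviation \<alpha> i P + deviation \<alpha> i (take (l - length P) z)"
        using deviation_append[of \<alpha> i P] l by simp
      also have "\<dots> \<le> e s * ?L + (e s / 4 * real (l - length P) + e s * ?L)"
      proof (intro add_mono)
        show "deviation \<alpha> i P \<le> e s * ?L" using P l(1) by (simp add: Inv_def)
        have "l - length P \<le> length z" using l(3) by simp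
        moreover have "?u \<le> e s * ?L" using P by (simp add: Inv_def)
        ultimately show "deviation \<alpha> i (take (l - length P) z) \<le> e s / 4 * real (l - length P) + e s * ?L"
          using dz[OF l(1)] by fastforce
      qed
      also have "\<dots> \<le> e s * real l + (e s * real l + e s * real l)"
        using l e(1)[of s] by (intro add_mono mult_mono) auto
      finally show "deviation \<alpha> i (take l (P @ z)) \<le> 3 * e s * real l" by (simp add: mult_ac)
    qed
    ultimately show "\<exists>P'. Inv (Suc s) P' \<and> Q s P P'" by blast
  qed
  then obtain P where P: "\<And>s. Inv s (P s)" "\<And>s. Q s (P s) (P (Suc s))" by blast
  define f where "f s = length (P s)" for s
  have f_less: "f s < f (Suc s)" for s
    using P(2)[of s] unfolding Q_def f_def by auto
  have f_ge: "s < f s" for s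
  proof (induction s)
    case 0
    show ?case using P(1)[of 0] by (simp add: Inv_def f_def)
  next
    case (Suc s)
    then show ?case using f_less[of s] by linarith
  qed
  have ext: "j < f s \<Longrightarrow> P (s + d) ! j = P s ! j \<and> j < f (s + d)" for s d j
  proof (induction d)
    case (Suc d)
    then show ?case using P(2)[of "s + d"] f_less[of "s+d"] unfolding Q_def f_def
      by (auto simp: nth_append)
  qed simp
  \<comment> \<open>\<open>P j\<close> has more than j letters, and later stages only extend
    it.\<close>
  define v where "v j = P j ! j" for j
  have v_eq: "v j = P s ! j" if "j < f s" for s j
    using ext[OF that, of "j - s"] ext[OF f_ge[of j], of "s - j"]
    by (cases "s \<le> j") (auto simp: v_def)
  have v_map: "map v [0..<l] = take l (P s)" if "l \<le> f s" for l s
    using that by (intro nth_equalityI) (auto simp: v_eq f_def)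
  have "v j < k" for j
    using P(1)[of j] f_ge[of j] unfolding v_def Inv_def f_def
    by (metis lessThan_iff nth_mem subsetD)
  then have "v \<in> seqs k" by (simp add: seqs_def)
  moreover have "less_fun ((shift ^^ r) v) w" for r
  proof (rule strictly_below_less_fun)
    show "strictly_below (drop r (P r)) w"
      using P(1)[of r] f_ge[of r] unfolding Inv_def f_def by (intro good_drop) auto
    show "starts (drop r (P r)) ((shift ^^ r) v)"
      by (auto simp: starts_iff shift_funpow add.commute v_eq f_def intro!: v_eq[of _ r, unfolded f_def])
  qed
  moreover have "has_freq k v \<alpha>"
    unfolding has_freq_def
  proof (intro allI impI)
    fix i assume "i < k"
    have bound: "\<bar>real (digit_count i l v) / real l - \<alpha> i\<bar> \<le> 3 * e s" if fl: "f s \<le> l" for s l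
    proof -
      obtain t where t: "t \<ge> s" "f t \<le> l" "l \<le> f (Suc t)"
        using exists_sandwich[of f, OF fl f_less] by blast
      have "deviation \<alpha> i (take l (P (Suc t))) \<le> 3 * e t * real l"
        using P(2)[of t] t \<open>i < k\<close> unfolding Q_def f_def by blast
      moreover have "length (take l (P (Suc t))) = l" using t by (simp add: f_def)
      ultimately have "\<bar>real (digit_count i l v) - \<alpha> i * real l\<bar> \<le> 3 * e t * real l"
        unfolding deviation_def digit_count_eq_count_list v_map[OF t(3)] by simp
      moreover have l: "0 < real l" using t f_ge[of t] by simp
      have "real (digit_count i l v) / real l - \<alpha> i = (real (digit_count i l v) - \<alpha> i * real l) / real l"
        using l by (simp add: field_simps)
      ultimately have "\<bar>real (digit_count i l v) / real l - \<alpha> i\<bar> \<le> 3 * e t"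
        using l by (simp add: pos_divide_le_eq)
      then show ?thesis using e_mono[OF t(1)] by linarith
    qed
    show "(\<lambda>r. real (digit_count i r v) / real r) \<longlonglongrightarrow> \<alpha> i"
    proof (rule LIMSEQ_I)
      fix \<epsilon> :: real assume "0 < \<epsilon>"
      obtain s where "inverse (real (Suc s)) < \<epsilon> / 3"
        using reals_Archimedean[of "\<epsilon> / 3"] \<open>0 < \<epsilon>\<close> by auto
      then have "3 * e s < \<epsilon>" by (simp add: e_def field_simps)
      then show "\<exists>no. \<forall>n\<ge>no. norm (real (digit_count i n v) / real n - \<alpha> i) < \<epsilon>"
        using bound by (intro exI[of _ "f s"]) (auto intro: le_less_trans)
    qed
  qed
  ultimately show ?thesis by blast
qed

section \<open>Good words under the substitutions\<close>

lemma strictly_below_sub: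
  assumes "w \<in> seqs k" "set x \<subseteq> {..<k}" "strictly_below x w"
  shows "strictly_below (sub n x) (subst_seq k n w)"
  using assms
proof (induction x arbitrary: w)
  case (Cons a x)
  have w0: "w 0 < k" and sw: "shift w \<in> seqs k" using Cons.prems(1) by (auto simp: seqs_def shift_def)
  show ?case
  proof (cases "a = w 0")
    case True
    then show ?thesis using Cons sw by (subst subst_seq_prepend) auto
  next
    case False
    with Cons.prems have a: "a < w 0" by simp
    show ?thesis
    proof (cases "a < k - 2")
      case True
      then have "subst_digit k n a = [a + 1]" by (simp add: subst_digit_def)
      moreover have "a + 1 < subst_seq k n w 0"
        using True a by (subst subst_seq_prepend) (auto simp: subst_digit_def)
      ultimately show ?thesis by simp
    next
      case False
      then have "a = k - 2" "w 0 = k - 1" using a w0 by linarith+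
      \<comment> \<open>The images of k - 2 and k - 1 agree up to \<open>0\<close> in the former
        against the nonzero first letter of the next image in the latter.\<close>
      then show ?thesis using subst_seq_0_pos[of n "shift w"]
        using strictly_below_prepend[of "(k - 1) # replicate n 0" "0 # sub n x" "subst_seq k n (shift w)"]
        by (subst subst_seq_prepend) (simp add: replicate_app_Cons_same)
    qed
  qed
qed simp

lemma good_zeros: "0 < w 0 \<Longrightarrow> good w y \<Longrightarrow> good w (replicate m 0 @ y)"
  by (induction m) auto

text \<open>An image is one letter followed by zeros: suffixes starting at that letter are covered
  by \<open>strictly_below_sub\<close>, those starting with 0 are below k - 1 at once.\<close>

lemma good_sub:
  assumes "w \<in> seqs k" "w 0 = k - 1" "set x \<subseteq> {..<k}" "good w x"
  shows "good (subst_seq k n w) (sub n x)"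
  using assms(3,4)
proof (induction x)
  case (Cons a x)
  have IH: "good (subst_seq k n w) (sub n x)" using Cons by simp
  have top: "subst_seq k n w 0 = k - 1" using assms(2) by (rule subst_seq_0)
  have sb: "strictly_below (sub n (a # x)) (subst_seq k n w)"
    using Cons.prems assms(1) by (intro strictly_below_sub) auto
  obtain b m where "subst_digit k n a = b # replicate m 0"
    unfolding subst_digit_def by (metis replicate_0)
  then show ?case using sb good_zeros[OF _ IH, of m] top k2 by simp
qed simp

lemma count_sub:
  assumes "set U \<subseteq> {..<k}"
  shows "count_list (sub n U) 0 = n * count_list U (k - 1) + (n + 1) * count_list U (k - 2)"
    and "count_list (sub n U) (k - 1) = count_list U (k - 1) + count_list U (k - 2)"
    and "i < k - 2 \<Longrightarrow> count_list (sub n U) (i + 1) = count_list U i"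
proof -
  have rep: "count_list (replicate m a) b = (if a = b then m else 0)" for m a b :: nat
    by (induction m) auto
  have digit: "count_list (subst_digit k n a) 0 = (if a = k - 1 then n else if a = k - 2 then n + 1 else 0)"
    "count_list (subst_digit k n a) (k - 1) = (if a = k - 1 \<or> a = k - 2 then 1 else 0)"
    "i < k - 2 \<Longrightarrow> count_list (subst_digit k n a) (i + 1) = (if a = i then 1 else 0)"
    if "a < k" for a i
    using that by (auto simp: subst_digit_def rep)
  show "count_list (sub n U) 0 = n * count_list U (k - 1) + (n + 1) * count_list U (k - 2)"
    using assms by (induction U) (auto simp: digit distrib_left)
  show "count_list (sub n U) (k - 1) = count_list U (k - 1) + count_list U (k - 2)"
    using assms by (induction U) (auto simp: digit)
  show "count_list (sub n U) (i + 1) = count_list U i" if "i < k - 2"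
    using assms that by (induction U) (auto simp: digit)
qed

lemma freq_simplex_bounds:
  assumes "\<alpha> \<in> freq_simplex k"
  shows "0 \<le> \<alpha> i" "\<alpha> i \<le> 1"
proof -
  show nn: "0 \<le> \<alpha> i" for i
    using assms by (cases "i < k") (auto simp: freq_simplex_def)
  show "\<alpha> i \<le> 1"
  proof (cases "i < k")
    case True
    then have "\<alpha> i \<le> (\<Sum>i<k. \<alpha> i)" using nn by (intro member_le_sum) auto
    then show ?thesis using assms by (simp add: freq_simplex_def)
  qed (use assms in \<open>auto simp: freq_simplex_def\<close>)
qed

section \<open>Approximating \<alpha> by good words\<close>

definition weight :: "nat list \<Rightarrow> nat \<Rightarrow> nat \<Rightarrow> real" where
  "weight U c i = real (count_list U i) + (if i = k - 1 then real c else 0)"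

lemma sum_weight: "set U \<subseteq> {..<k} \<Longrightarrow> (\<Sum>i<k. weight U c i) = real (length U + c)"
  using sum_count_set[of U "{..<k}"]
  by (simp add: weight_def sum.distrib flip: of_nat_sum)

text \<open>A word containing \<open>k - 1\<close> need not be good, so the digits \<open>k - 1\<close> are removed, but
  still counted by \<open>c\<close>. Each application of \<open>\<Lambda>\<^sub>n\<close> turns \<open>c\<close> removed digits \<open>k - 1\<close> into
  \<open>c\<close> removed digits and \<open>n * c\<close> zeros that may be kept, so the removed proportion, at most
  \<open>1 / L\<close>, tends to zero.\<close>

definition nearly_good :: "(nat \<Rightarrow> real) \<Rightarrow> nat \<Rightarrow> bool" where
  "nearly_good \<alpha> L \<longleftrightarrow> (\<forall>\<epsilon>>0. \<exists>U c. set U \<subseteq> {..<k} \<and> good (inf_seq k \<alpha>) U \<and>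
     0 < length U + c \<and> c * L \<le> length U + c \<and>
     (\<forall>i<k. \<bar>weight U c i - \<alpha> i * real (length U + c)\<bar> \<le> \<epsilon> * real (length U + c)))"

lemma nearly_good_step:
  assumes \<alpha>: "\<alpha> \<in> top_simplex" and L: "nearly_good (K_map k \<alpha>) L"
  shows "nearly_good \<alpha> (L + J_map k \<alpha>)"
  unfolding nearly_good_def
proof (intro allI impI)
  fix \<epsilon> :: real assume "0 < \<epsilon>"
  define n where "n = J_map k \<alpha>"
  define \<kappa> where "\<kappa> = K_map k \<alpha>"
  \<comment> \<open>One level magnifies the errors by at most
    \<open>4 * (real n + 1)\<close>.\<close>
  define \<delta> where "\<delta> = \<epsilon> / (4 * (real n + 1))"
  have \<delta>: "0 < \<delta>" "4 * (real n + 1) * \<delta> = \<epsilon>" using \<open>0 < \<epsilon>\<close> by (auto simp: \<delta>_def)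
  obtain U c where U: "set U \<subseteq> {..<k}" "good (inf_seq k \<kappa>) U" "0 < length U + c"
    "c * L \<le> length U + c"
    "\<And>i. i < k \<Longrightarrow> \<bar>weight U c i - \<kappa> i * real (length U + c)\<bar> \<le> \<delta> * real (length U + c)"
    using L[unfolded nearly_good_def, rule_format, OF \<delta>(1), folded \<kappa>_def] by auto
  define T where "T = real (length U + c)"
  define er where "er i = weight U c i - \<kappa> i * T" for i
  have er: "\<bar>er i\<bar> \<le> \<delta> * T" if "i < k" for i using U(5)[OF that] by (simp add: er_def T_def)
  \<comment> \<open>The images of the c removed digits lose their k - 1, still counted by c, but
    keep their n zeros each. These go to the end, as counts ignore order.\<close>
  define V where "V = sub n U @ replicate (n * c) 0"
  have V: "set V \<subseteq> {..<k}" using sub_less[OF U(1), of n] k2 by (auto simp: V_def)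
  have rep: "count_list (replicate m 0) b = (if b = 0 then m else 0)" for m b :: nat
    by (induction m) auto
  have w0: "weight V c 0 = real n * weight U c (k - 1) + (real n + 1) * weight U c (k - 2)"
    using k_diff_simps by (simp add: weight_def V_def rep count_sub[OF U(1)] algebra_simps)
  have w1: "weight V c (k - 1) = weight U c (k - 1) + weight U c (k - 2)"
    by (simp add: weight_def V_def rep count_sub[OF U(1)])
  have w2: "weight V c (i + 1) = weight U c i" if "i < k - 2" for i
    using that by (auto simp: weight_def V_def rep count_sub[OF U(1)])
  \<comment> \<open>Each image has exactly one nonzero letter, so the total grows by the number of
    zeros.\<close>
  have T': "real (length V + c) = T + weight V c 0"
    unfolding sum_weight[OF V, symmetric] T_def sum_weight[OF U(1), symmetric]
    unfolding sum_split_ends(1)[of "weight U c"] sum_split_ends(2)[of "weight V c"]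
    using w1 w2 by simp
  note D = top_simplexD[OF \<alpha>]
  \<comment> \<open>The ideal number of new zeros per counted digit;
    \<open>(1 - \<alpha> 0) * (1 + a) = 1\<close> then gives the ideal growth of the total.\<close>
  define a where "a = real n * \<kappa> (k - 1) + (real n + 1) * \<kappa> (k - 2)"
  have d: "1 - \<alpha> 0 \<noteq> 0" using D(3) by simp
  have K: "(1 - \<alpha> 0) * \<kappa> (k-2) = \<alpha> 0 - real n * \<alpha> (k-1)"
    "(1 - \<alpha> 0) * \<kappa> (k-1) = (real n + 1) * \<alpha> (k-1) - \<alpha> 0"
    "\<And>i. i < k - 2 \<Longrightarrow> (1 - \<alpha> 0) * \<kappa> i = \<alpha> (i+1)"
    using d by (simp_all add: K_map_simps \<kappa>_def n_def)
  have "(1 - \<alpha> 0) * a = real n * ((1 - \<alpha> 0) * \<kappa> (k - 1)) + (real n + 1) * ((1 - \<alpha> 0) * \<kappa> (k - 2))"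
    by (simp add: a_def algebra_simps)
  also have "\<dots> = \<alpha> 0" unfolding K by (simp add: algebra_simps)
  finally have a: "(1 - \<alpha> 0) * a = \<alpha> 0" .
  then have a': "(1 - \<alpha> 0) * (1 + a) = 1" by (simp add: algebra_simps)
  define E where "E = real n * er (k - 1) + (real n + 1) * er (k - 2)"
  have Tpos: "0 < T" unfolding T_def using U(3) by (simp only: of_nat_0_less_iff)
  have "\<bar>real n * er (k - 1)\<bar> \<le> real n * (\<delta> * T)" "\<bar>(real n + 1) * er (k - 2)\<bar> \<le> (real n + 1) * (\<delta> * T)"
    using er[of "k-1"] er[of "k-2"] k2 by (auto simp: abs_mult intro!: mult_left_mono)
  then have "\<bar>E\<bar> \<le> real n * (\<delta> * T) + (real n + 1) * (\<delta> * T)"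
    unfolding E_def by linarith
  then have E: "\<bar>E\<bar> \<le> (2 * real n + 1) * (\<delta> * T)" by (simp add: algebra_simps)
  have w0': "weight V c 0 = a * T + E"
    by (simp add: w0 a_def E_def er_def algebra_simps)
  have len: "real (length V + c) = T * (1 + a) + E" unfolding T' w0' by (simp add: algebra_simps)
  have TV: "T \<le> real (length V + c)" unfolding T' by (simp add: weight_def)
  have scale: "(1 - \<alpha> 0) * x * real (length V + c) = x * T + (1 - \<alpha> 0) * x * E" for x
  proof -
    have "(1 - \<alpha> 0) * x * real (length V + c) = x * T * ((1 - \<alpha> 0) * (1 + a)) + (1 - \<alpha> 0) * x * E"
      unfolding len by (simp add: algebra_simps)
    then show ?thesis unfolding a' by simp
  qed
  have \<alpha>E: "\<bar>\<alpha> i * E\<bar> \<le> (2 * real n + 1) * (\<delta> * T)" for i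
  proof -
    have "\<bar>\<alpha> i\<bar> \<le> 1" using freq_simplex_bounds[of \<alpha> i] \<alpha> by (auto simp: top_simplex_def)
    then have "\<bar>\<alpha> i * E\<bar> \<le> 1 * \<bar>E\<bar>" unfolding abs_mult by (intro mult_right_mono) auto
    then show ?thesis using E by linarith
  qed
  have small: "x \<le> \<epsilon> * real (length V + c)" if "x \<le> (4 * real n + 4) * (\<delta> * T)" for x
  proof -
    have "(4 * real n + 4) * (\<delta> * T) = 4 * (real n + 1) * \<delta> * T" by (simp add: algebra_simps)
    also have "\<dots> = \<epsilon> * T" unfolding \<delta>(2) ..
    also have "\<dots> \<le> \<epsilon> * real (length V + c)" using TV \<open>0 < \<epsilon>\<close> by (intro mult_left_mono) auto
    finally show ?thesis using that by linarith
  qed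
  have \<delta>T: "0 \<le> \<delta> * T" "0 \<le> real n * (\<delta> * T)" using \<delta> Tpos by auto
  have mult: "(2 * real n + 1) * (\<delta> * T) = 2 * (real n * (\<delta> * T)) + \<delta> * T"
    "(4 * real n + 4) * (\<delta> * T) = 4 * (real n * (\<delta> * T)) + 4 * (\<delta> * T)"
    by (simp_all add: algebra_simps)
  have "\<bar>weight V c i - \<alpha> i * real (length V + c)\<bar> \<le> \<epsilon> * real (length V + c)" if "i < k" for i
  proof -
    have "i = 0 \<or> i = k - 1 \<or> (\<exists>j<k-2. i = j + 1)"
    proof (cases i)
      case (Suc j)
      then show ?thesis using that by (cases "j < k - 2") auto
    qed simp
    then consider "i = 0" | "i = k - 1" | j where "j < k - 2" "i = j + 1" by blast
    then show ?thesis
    proof cases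
      case 1
      have "\<alpha> 0 * real (length V + c) = a * T + \<alpha> 0 * E"
        using scale[of a] unfolding a .
      then have "weight V c i - \<alpha> i * real (length V + c) = E - \<alpha> 0 * E"
        unfolding 1 w0' by simp
      then show ?thesis using E \<alpha>E[of 0] \<delta>T unfolding mult by (intro small[unfolded mult]) linarith
    next
      case 2
      have "(1 - \<alpha> 0) * (\<kappa> (k-1) + \<kappa> (k-2)) = \<alpha> (k-1)"
        using K(1,2) by (simp add: algebra_simps)
      then have "\<alpha> (k-1) * real (length V + c) = (\<kappa> (k-1) + \<kappa> (k-2)) * T + \<alpha> (k-1) * E"
        using scale[of "\<kappa> (k-1) + \<kappa> (k-2)"] by simp
      then have "weight V c i - \<alpha> i * real (length V + c) = er (k-1) + er (k-2) - \<alpha> (k-1) * E"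
        unfolding 2 w1 by (simp add: er_def algebra_simps)
      then show ?thesis using er[of "k-1"] er[of "k-2"] \<alpha>E[of "k-1"] \<delta>T k2
        unfolding mult by (intro small[unfolded mult]) linarith
    next
      case 3
      have "\<alpha> i * real (length V + c) = \<kappa> j * T + \<alpha> i * E"
        using scale[of "\<kappa> j"] K(3)[OF 3(1)] 3(2) by simp
      then have "weight V c i - \<alpha> i * real (length V + c) = er j - \<alpha> i * E"
        using w2[OF 3(1)] 3(2) by (simp add: er_def algebra_simps)
      then show ?thesis using er[of j] \<alpha>E[of i] \<delta>T 3
        unfolding mult by (intro small[unfolded mult]) linarith
    qed
  qed
  moreover have "good (inf_seq k \<alpha>) V"
  proof -
    have \<kappa>: "\<kappa> \<in> top_simplex" using K_map_top_simplex[OF \<alpha>] by (simp add: \<kappa>_def)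
    have "good (inf_seq k \<alpha>) (sub n U)"
      unfolding inf_seq_rec[OF \<alpha>] n_def[symmetric] \<kappa>_def[symmetric]
      using \<kappa> U inf_seq_in_seqs[of \<kappa>] inf_seq_top[of \<kappa>]
      by (intro good_sub) (auto simp: top_simplex_def)
    moreover have "0 < inf_seq k \<alpha> 0" using inf_seq_top[of \<alpha>] \<alpha> k2 by (simp add: top_simplex_def)
    ultimately show ?thesis
      unfolding V_def using good_zeros[of "inf_seq k \<alpha>" "[]"] by (intro good_append) auto
  qed
  moreover have "0 < length V + c" using TV Tpos by linarith
  \<comment> \<open>The appended \<open>n * c\<close> zeros raise the bound from L to L + n.\<close>
  moreover have "c * (L + n) \<le> length V + c"
    using U(4) length_sub_ge[of U n] by (simp add: V_def algebra_simps)
  ultimately show "\<exists>U c. set U \<subseteq> {..<k} \<and> good (inf_seq k \<alpha>) U \<and>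
     0 < length U + c \<and> c * (L + J_map k \<alpha>) \<le> length U + c \<and>
     (\<forall>i<k. \<bar>weight U c i - \<alpha> i * real (length U + c)\<bar> \<le> \<epsilon> * real (length U + c))"
    using V unfolding n_def by blast
qed

text \<open>Proportions are rounded down and k - 1 is counted only by c. Words without k - 1 are
  good, so this starts the level induction and settles the case
  \<open>\<alpha> (k - 1) = 0\<close>.\<close>

lemma exists_floor_word:
  assumes \<alpha>: "\<alpha> \<in> freq_simplex k" and "0 < \<epsilon>"
  shows "\<exists>U c. set U \<subseteq> {..<k-1} \<and> 0 < length U + c \<and> (\<alpha> (k - 1) = 0 \<longrightarrow> c = 0) \<and>
    (\<forall>i<k. \<bar>weight U c i - \<alpha> i * real (length U + c)\<bar> \<le> \<epsilon> * real (length U + c))"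
proof -
  \<comment> \<open>Rounding loses at most k of M letters, so counts are off by at most k + 1; this
    M makes that at most \<epsilon> times the total.\<close>
  obtain M where M: "real k + 1 + (real k + 1) / \<epsilon> \<le> real M" using real_arch_simple by blast
  define a where "a i = nat \<lfloor>\<alpha> i * real M\<rfloor>" for i
  have a: "real (a i) \<le> \<alpha> i * real M" "\<alpha> i * real M < real (a i) + 1" for i
    using freq_simplex_bounds[OF \<alpha>, of i] unfolding a_def by (auto; linarith)+
  define U where "U = concat (map (\<lambda>i. replicate (a i) i) [0..<k-1])"
  have rep: "count_list (replicate m a) b = (if a = b then m else 0)" for m a b :: nat
    by (induction m) auto
  have "count_list (concat (map (\<lambda>i. replicate (a i) i) [0..<m])) i = (if i < m then a i else 0)" for i m
    by (induction m) (auto simp: rep)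
  then have w: "weight U (a (k - 1)) i = real (a i)" if "i < k" for i
    using that by (auto simp: weight_def U_def)
  have set: "set U \<subseteq> {..<k-1}" by (auto simp: U_def)
  then have "set U \<subseteq> {..<k}" by auto
  from sum_weight[OF this, of "a (k - 1)"] have T: "real (length U + a (k - 1)) = (\<Sum>i<k. real (a i))"
    using w by simp
  define T where "T = real (length U + a (k - 1))"
  have S: "(\<Sum>i<k. \<alpha> i * real M) = real M"
    using \<alpha> by (simp add: freq_simplex_def flip: sum_distrib_right)
  have "T \<le> real M" using sum_mono[of "{..<k}" "\<lambda>i. real (a i)" "\<lambda>i. \<alpha> i * real M"] a S
    unfolding T_def T by simp
  have "(\<Sum>i<k. \<alpha> i * real M) \<le> (\<Sum>i<k. real (a i) + 1)"
    using a by (intro sum_mono less_imp_le)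
  then have "real M \<le> (\<Sum>i<k. real (a i) + 1)" using S by simp
  then have "real M - real k \<le> T" unfolding T_def T by (simp add: sum.distrib)
  have "0 < (real k + 1) / \<epsilon>" using \<open>0 < \<epsilon>\<close> by simp
  then have "0 < T" "(real k + 1) / \<epsilon> \<le> T" using M \<open>real M - real k \<le> T\<close> by linarith+
  then have eT: "real k + 1 \<le> \<epsilon> * T" using \<open>0 < \<epsilon>\<close> by (simp add: field_simps)
  have "\<bar>weight U (a (k - 1)) i - \<alpha> i * T\<bar> \<le> \<epsilon> * T" if "i < k" for i
  proof -
    have "\<alpha> i * (real M - T) \<le> 1 * (real M - T)"
      using freq_simplex_bounds[OF \<alpha>, of i] \<open>T \<le> real M\<close> by (intro mult_right_mono) auto
    moreover have "0 \<le> \<alpha> i * (real M - T)"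
      using freq_simplex_bounds[OF \<alpha>, of i] \<open>T \<le> real M\<close> by simp
    ultimately have "0 \<le> \<alpha> i * real M - \<alpha> i * T" "\<alpha> i * real M - \<alpha> i * T \<le> real k"
      using \<open>real M - real k \<le> T\<close> by (auto simp: algebra_simps)
    then show ?thesis unfolding w[OF that] using a[of i] eT by linarith
  qed
  moreover have "0 < length U + a (k - 1)" using \<open>0 < T\<close> unfolding T_def by linarith
  moreover have "\<alpha> (k - 1) = 0 \<longrightarrow> a (k - 1) = 0" by (simp add: a_def)
  ultimately show ?thesis using set unfolding T_def by blast
qed

text \<open>Every nonempty suffix of \<open>replicate M (k - 1) @ [0]\<close> ends in a 0, below k -
  1. Nothing is removed, so c = 0 serves every L.\<close>

lemma nearly_good_corner: "nearly_good corner L"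
  unfolding nearly_good_def
proof (intro allI impI)
  fix \<epsilon> :: real assume "0 < \<epsilon>"
  obtain M where M: "1 / \<epsilon> \<le> real M" using real_arch_simple by blast
  let ?U = "replicate M (k - 1) @ [0]"
  have good: "good (\<lambda>_. k - 1) (replicate M (k - 1) @ [0])" for M
  proof -
    have below: "strictly_below (replicate M (k - 1) @ [0]) (\<lambda>_. k - 1)" for M
      using k2 by (induction M) (auto simp: shift_def)
    show ?thesis
    proof (induction M)
      case (Suc M)
      then show ?case using below[of "Suc M"] by simp
    qed (use below[of 0] in simp)
  qed
  have rep: "count_list (replicate m a) b = (if a = b then m else 0)" for m a b :: nat
    by (induction m) auto
  have "1 \<le> \<epsilon> * real M" using M \<open>0 < \<epsilon>\<close> by (simp add: field_simps)
  then have "1 \<le> \<epsilon> * real (length ?U + 0)" using \<open>0 < \<epsilon>\<close> by (simp add: algebra_simps)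
  moreover have "\<bar>weight ?U 0 i - corner i * real (length ?U + 0)\<bar> \<le> 1" for i
    by (auto simp: weight_def corner_def rep)
  ultimately have "\<forall>i<k. \<bar>weight ?U 0 i - corner i * real (length ?U + 0)\<bar> \<le> \<epsilon> * real (length ?U + 0)"
    by (meson order_trans)
  moreover have "set ?U \<subseteq> {..<k}" using k2 by auto
  ultimately show "\<exists>U c. set U \<subseteq> {..<k} \<and> good (inf_seq k corner) U \<and>
     0 < length U + c \<and> c * L \<le> length U + c \<and>
     (\<forall>i<k. \<bar>weight U c i - corner i * real (length U + c)\<bar> \<le> \<epsilon> * real (length U + c))"
    using good[of M] unfolding inf_seq_corner by (intro exI[of _ ?U] exI[of _ 0] conjI) auto
qed

lemma nearly_good:
  assumes "\<alpha> \<in> top_simplex"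
  shows "nearly_good \<alpha> L"
proof (rule level_induct[where P = nearly_good])
  fix \<alpha> assume \<alpha>: "\<alpha> \<in> top_simplex"
  then have \<alpha>': "\<alpha> \<in> freq_simplex k" by (simp add: top_simplex_def)
  show "nearly_good \<alpha> 1"
    unfolding nearly_good_def
  proof (intro allI impI)
    fix \<epsilon> :: real assume "0 < \<epsilon>"
    then obtain U c where U: "set U \<subseteq> {..<k-1}" "0 < length U + c"
      "\<forall>i<k. \<bar>weight U c i - \<alpha> i * real (length U + c)\<bar> \<le> \<epsilon> * real (length U + c)"
      using exists_floor_word[OF \<alpha>' \<open>0 < \<epsilon>\<close>] by auto
    moreover have "good (inf_seq k \<alpha>) U" using U(1) inf_seq_top[OF \<alpha>'] by (intro good_small) simp
    moreover have "set U \<subseteq> {..<k}" using U(1) by auto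
    ultimately show "\<exists>U c. set U \<subseteq> {..<k} \<and> good (inf_seq k \<alpha>) U \<and>
     0 < length U + c \<and> c * 1 \<le> length U + c \<and>
     (\<forall>i<k. \<bar>weight U c i - \<alpha> i * real (length U + c)\<bar> \<le> \<epsilon> * real (length U + c))"
      by (intro exI[of _ U] exI[of _ c]) simp
  qed
next
  fix \<alpha> m m' assume "nearly_good \<alpha> m" "m' \<le> m"
  then show "nearly_good \<alpha> m'" unfolding nearly_good_def by (meson le_trans mult_le_mono2)
qed (use assms nearly_good_step nearly_good_corner in auto)

theorem exists_strictly_below_inf_seq:
  assumes \<alpha>: "\<alpha> \<in> freq_simplex k"
  shows "\<exists>v\<in>seqs k. (\<forall>r. less_fun ((shift ^^ r) v) (inf_seq k \<alpha>)) \<and> has_freq k v \<alpha>"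
proof (rule good_concatenation)
  fix \<epsilon> :: real assume "0 < \<epsilon>"
  show "\<exists>U. U \<noteq> [] \<and> set U \<subseteq> {..<k} \<and> good (inf_seq k \<alpha>) U \<and>
       (\<forall>i<k. deviation \<alpha> i U \<le> \<epsilon> * real (length U))"
  proof (cases "\<alpha> \<in> top_simplex")
    case False
    then have "\<alpha> (k - 1) = 0" using \<alpha> by (simp add: top_simplex_def)
    then obtain U where U: "set U \<subseteq> {..<k-1}" "0 < length U"
      "\<forall>i<k. \<bar>weight U 0 i - \<alpha> i * real (length U + 0)\<bar> \<le> \<epsilon> * real (length U + 0)"
      using exists_floor_word[OF \<alpha> \<open>0 < \<epsilon>\<close>] by (metis add_0_right)
    moreover have "good (inf_seq k \<alpha>) U" using U(1) inf_seq_top[OF \<alpha>] by (intro good_small) simp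
    moreover have "set U \<subseteq> {..<k}" using U(1) by auto
    moreover have "weight U 0 i = real (count_list U i)" for i by (simp add: weight_def)
    ultimately show ?thesis by (intro exI[of _ U]) (simp add: deviation_def)
  next
    case True
    \<comment> \<open>The 2 makes \<open>length U\<close> at least half of the total T, and
      \<open>4 / \<epsilon>\<close> makes c at most \<open>\<epsilon> / 4 * T\<close>.\<close>
    obtain L where L: "4 / \<epsilon> + 2 \<le> real L" using real_arch_simple by blast
    have "0 < 4 / \<epsilon>" using \<open>0 < \<epsilon>\<close> by simp
    obtain U c where U: "set U \<subseteq> {..<k}" "good (inf_seq k \<alpha>) U" "0 < length U + c"
      "c * L \<le> length U + c"
      "\<And>i. i < k \<Longrightarrow> \<bar>weight U c i - \<alpha> i * real (length U + c)\<bar> \<le> \<epsilon> / 4 * real (length U + c)"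
      using nearly_good[OF True, of L] \<open>0 < \<epsilon>\<close> unfolding nearly_good_def
      by (metis divide_pos_pos zero_less_numeral)
    define T where "T = real (length U + c)"
    have cL: "real c * real L \<le> T" using U(4) unfolding T_def by (metis of_nat_le_iff of_nat_mult)
    have "real c * 2 \<le> real c * real L" "real c * (4 / \<epsilon>) \<le> real c * real L"
      using L \<open>0 < 4 / \<epsilon>\<close> by (intro mult_left_mono; linarith)+
    then have c2: "real c * 2 \<le> T" and "real c * (4 / \<epsilon>) \<le> T" using cL by linarith+
    then have c\<epsilon>: "real c \<le> \<epsilon> / 4 * T" using \<open>0 < \<epsilon>\<close> by (simp add: field_simps)
    have T2: "T \<le> 2 * real (length U)" using c2 by (simp add: T_def)
    have "0 < T" unfolding T_def using U(3) by (simp only: of_nat_0_less_iff)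
    then have "U \<noteq> []" using T2 by auto
    moreover have "deviation \<alpha> i U \<le> \<epsilon> * real (length U)" if "i < k" for i
    proof -
      have "0 \<le> \<alpha> i * real c" "\<alpha> i * real c \<le> real c"
        using freq_simplex_bounds[OF \<alpha>, of i] by (auto intro: mult_left_le_one_le)
      moreover have "\<bar>weight U c i - (\<alpha> i * real (length U) + \<alpha> i * real c)\<bar> \<le> \<epsilon> / 4 * T"
        using U(5)[OF that] by (simp add: T_def algebra_simps)
      moreover obtain r where "weight U c i = real (count_list U i) + r" "0 \<le> r" "r \<le> real c"
        unfolding weight_def by (metis of_nat_0_le_iff order_refl)
      ultimately have "deviation \<alpha> i U \<le> \<epsilon> / 4 * T + real c"
        unfolding deviation_def by linarith
      also have "\<dots> \<le> \<epsilon> / 2 * T" using c\<epsilon> by linarith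
      also have "\<dots> \<le> \<epsilon> / 2 * (2 * real (length U))" using T2 \<open>0 < \<epsilon>\<close> by (intro mult_left_mono) auto
      finally show ?thesis by simp
    qed
    ultimately show ?thesis using U(1,2) by blast
  qed
qed (use freq_simplex_bounds[OF \<alpha>] in auto)

lemma DF_subset_DF': "DF k w \<subseteq> DF' k w"
  unfolding DF_def DF'_def has_freq_def has_subseq_freq_def
  using filterlim_ident[of sequentially] by (auto intro!: bexI exI[of _ "\<lambda>r. r"])

theorem DF_eq:
  assumes "w 0 = k - 1"
  shows "DF' k w = {\<alpha> \<in> freq_simplex k. inf_seq k \<alpha> \<preceq> w}"
    and "DF k w = {\<alpha> \<in> freq_simplex k. inf_seq k \<alpha> \<preceq> w}"
proof -
  have "DF' k w \<subseteq> {\<alpha> \<in> freq_simplex k. inf_seq k \<alpha> \<preceq> w}"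
    using inf_seq_le_if_subseq_freq[of w] assms by (auto simp: DF'_def)
  moreover have "{\<alpha> \<in> freq_simplex k. inf_seq k \<alpha> \<preceq> w} \<subseteq> DF k w"
  proof
    fix \<alpha> assume "\<alpha> \<in> {\<alpha> \<in> freq_simplex k. inf_seq k \<alpha> \<preceq> w}"
    then have \<alpha>: "\<alpha> \<in> freq_simplex k" "inf_seq k \<alpha> \<preceq> w" by auto
    obtain v where v: "v \<in> seqs k" "\<And>r. less_fun ((shift ^^ r) v) (inf_seq k \<alpha>)" "has_freq k v \<alpha>"
      using exists_strictly_below_inf_seq[OF \<alpha>(1)] by blast
    have "(shift ^^ r) v \<preceq> w" for r
      using less_fun_lex_le_trans[OF v(2) \<alpha>(2)] by (simp add: lex_le_def)
    then show "\<alpha> \<in> DF k w" using v \<alpha> by (auto simp: DF_def beta_shift_def)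
  qed
  ultimately show "DF' k w = {\<alpha> \<in> freq_simplex k. inf_seq k \<alpha> \<preceq> w}"
    "DF k w = {\<alpha> \<in> freq_simplex k. inf_seq k \<alpha> \<preceq> w}"
    using DF_subset_DF'[of w] by auto
qed

end

section \<open>Expansions in base \<open>\<beta>\<close>\<close>

locale beta_expansion = digit_alphabet +
  fixes \<beta> :: real
  assumes \<beta>_gt: "real k - 1 < \<beta>" and \<beta>_less: "\<beta> < real k"
begin

lemma \<beta>_gt_1: "1 < \<beta>"
  using \<beta>_gt k2 by linarith

definition val :: "(nat \<Rightarrow> nat) \<Rightarrow> real" where
  "val v = (\<Sum>r. real (v r) / \<beta> ^ (r + 1))"

lemma summable_bound: "summable (\<lambda>r. real k / \<beta> ^ (r + 1))"
proof -
  have "summable (\<lambda>r. real k / \<beta> * (1 / \<beta>) ^ r)"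
    using \<beta>_gt_1 by (intro summable_mult summable_geometric) simp
  then show ?thesis by (simp add: power_one_over field_simps flip: Suc_eq_plus1)
qed

lemma summable_val: "v \<in> seqs k \<Longrightarrow> summable (\<lambda>r. real (v r) / \<beta> ^ (r + 1))"
  using \<beta>_gt_1 by (intro summable_comparison_test'[OF summable_bound, of 0])
    (auto simp: seqs_def less_imp_le intro!: divide_right_mono)

lemma is_expansion_iff: "is_expansion k \<beta> x v \<longleftrightarrow> v \<in> seqs k \<and> val v = x"
  using summable_val unfolding is_expansion_def val_def by (auto simp: sums_iff)

lemma shift_seqs: "v \<in> seqs k \<Longrightarrow> (shift ^^ r) v \<in> seqs k"
  by (simp add: shift_funpow seqs_def)

lemma val_nonneg: "0 \<le> val v" if "v \<in> seqs k"
  unfolding val_def using summable_val[OF that] \<beta>_gt_1 by (intro suminf_nonneg) auto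

lemma val_le: "val v \<le> (\<Sum>r. real k / \<beta> ^ (r + 1))" if "v \<in> seqs k"
  unfolding val_def using summable_val[OF that] summable_bound that \<beta>_gt_1
  by (intro suminf_le) (auto simp: seqs_def less_imp_le intro!: divide_right_mono)

lemma val_Suc:
  assumes "v \<in> seqs k"
  shows "\<beta> * val ((shift ^^ r) v) = real (v r) + val ((shift ^^ Suc r) v)"
proof -
  define u where "u = (shift ^^ r) v"
  have u: "u \<in> seqs k" using assms by (simp add: u_def shift_seqs)
  have su: "shift u \<in> seqs k" using u by (simp add: seqs_def shift_def)
  have "val u = real (u 0) / \<beta> + (\<Sum>r. real (u (Suc r)) / \<beta> ^ (Suc r + 1))"
    using suminf_split_head[OF summable_val[OF u]] by (simp add: val_def)
  also have "(\<Sum>r. real (u (Suc r)) / \<beta> ^ (Suc r + 1)) = (\<Sum>r. real (shift u r) / \<beta> ^ (r + 1) / \<beta>)"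
    by (simp add: shift_def field_simps flip: Suc_eq_plus1)
  also have "\<dots> = val (shift u) / \<beta>"
    unfolding val_def by (rule suminf_divide[OF summable_val[OF su]])
  finally have "\<beta> * val u = real (u 0) + val (shift u)"
    using \<beta>_gt_1 by (simp add: field_simps)
  then show ?thesis by (simp add: u_def shift_funpow shift_def)
qed

lemma val_diff:
  assumes "u \<in> seqs k" "v \<in> seqs k" "\<And>j. j < i \<Longrightarrow> u j = v j"
  shows "\<beta> ^ i * (val u - val v) = val ((shift ^^ i) u) - val ((shift ^^ i) v)"
  using assms(3)
proof (induction i)
  case (Suc i)
  then have "\<beta> ^ Suc i * (val u - val v) = \<beta> * (val ((shift ^^ i) u) - val ((shift ^^ i) v))"
    by simp
  also have "\<dots> = val ((shift ^^ Suc i) u) - val ((shift ^^ Suc i) v)"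
    unfolding right_diff_distrib val_Suc[OF assms(1)] val_Suc[OF assms(2)]
    using Suc.prems[of i] by simp
  finally show ?case .
qed simp

text \<open>The error is multiplied by \<beta> > 1 in each step and yet stays bounded, so it is
  0.\<close>

lemma val_eqI:
  assumes v: "v \<in> seqs k" and x: "\<And>r. 0 \<le> x r" "\<And>r. x r \<le> 1"
    and rec: "\<And>r. \<beta> * x r = real (v r) + x (Suc r)"
  shows "val ((shift ^^ r) v) = x r"
proof -
  define y where "y r = x r - val ((shift ^^ r) v)" for r
  define B where "B = 1 + (\<Sum>r. real k / \<beta> ^ (r + 1))"
  have bound: "\<bar>y r\<bar> < B + 1" for r
    using x[of r] val_nonneg[OF shift_seqs[OF v], of r] val_le[OF shift_seqs[OF v], of r]
    unfolding y_def B_def by linarith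
  have "y (Suc r) = \<beta> * y r" for r
    unfolding y_def right_diff_distrib rec val_Suc[OF v] by simp
  then have pow: "y (r + n) = \<beta> ^ n * y r" for r n
    by (induction n) simp_all
  have "y r = 0" for r
  proof (rule ccontr)
    assume "y r \<noteq> 0"
    obtain n where "(B + 1) / \<bar>y r\<bar> < \<beta> ^ n" using real_arch_pow[OF \<beta>_gt_1] by blast
    then have "B + 1 < \<beta> ^ n * \<bar>y r\<bar>" using \<open>y r \<noteq> 0\<close> by (simp add: field_simps)
    then show False using bound[of "r + n"] \<beta>_gt_1 by (simp add: pow abs_mult)
  qed
  then show ?thesis by (simp add: y_def)
qed

text \<open>A larger sequence of the same value would gain at least 1 at the first difference, more
  than the tail of v can make up.\<close>

lemma greedy_eqI:
  assumes v: "v \<in> seqs k" and tails: "\<And>r. val ((shift ^^ Suc r) v) < 1"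
  shows "greedy k \<beta> (val v) = v"
  unfolding greedy_def is_expansion_iff
proof (rule the_equality)
  have max: "u \<preceq> v" if u: "u \<in> seqs k" "val u = val v" for u
  proof (rule ccontr)
    assume "\<not> u \<preceq> v"
    then have "less_fun v u" using lex_linear by blast
    then obtain i where i: "v i < u i" "\<And>j. j < i \<Longrightarrow> v j = u j" by (auto elim: less_funE)
    have "val ((shift ^^ i) u) = val ((shift ^^ i) v)"
      using val_diff[OF u(1) v, of i] i(2) u(2) by simp
    then have "real (u i) + val ((shift ^^ Suc i) u) = real (v i) + val ((shift ^^ Suc i) v)"
      unfolding val_Suc[OF u(1), symmetric] val_Suc[OF v, symmetric] by simp
    then show False
      using i(1) tails[of i] val_nonneg[OF shift_seqs[OF u(1)], of "Suc i"] by linarith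
  qed
  then show "(v \<in> seqs k \<and> val v = val v) \<and> (\<forall>u. u \<in> seqs k \<and> val u = val v \<longrightarrow> u \<preceq> v)"
    using v by blast
  fix u assume "(u \<in> seqs k \<and> val u = val v) \<and> (\<forall>u'. u' \<in> seqs k \<and> val u' = val v \<longrightarrow> u' \<preceq> u)"
  then show "u = v" using max v lex_le_antisym by blast
qed

lemma greedy_expansion:
  assumes "0 \<le> x" "x \<le> 1"
  shows "greedy k \<beta> x \<in> seqs k" "val (greedy k \<beta> x) = x"
    "val ((shift ^^ Suc r) (greedy k \<beta> x)) < 1"
proof -
  \<comment> \<open>The \<beta>-transformation. Its iterates are below 1 from the first on; x itself
    may be 1.\<close>
  define T where "T y = \<beta> * y - of_int \<lfloor>\<beta> * y\<rfloor>" for y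
  define xs where "xs r = (T ^^ r) x" for r
  define v where "v r = nat \<lfloor>\<beta> * xs r\<rfloor>" for r
  have T: "0 \<le> T y" "T y < 1" for y by (simp_all add: T_def) linarith+
  have "0 \<le> xs r \<and> xs r \<le> 1" for r
  proof (cases r)
    case 0
    then show ?thesis using assms by (simp add: xs_def)
  next
    case (Suc n)
    then show ?thesis using T[of "xs n"] by (simp add: xs_def)
  qed
  then have xs: "0 \<le> xs r" "xs r \<le> 1" for r by auto
  have pos: "0 \<le> \<beta> * xs r" for r using xs(1)[of r] \<beta>_gt_1 by simp
  have "\<beta> * xs r < real k" for r
    using mult_left_le[OF xs(2), of \<beta> r] \<beta>_gt_1 \<beta>_less by linarith
  then have v: "v \<in> seqs k" using pos by (auto simp: seqs_def v_def nat_less_iff floor_less_iff)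
  have "\<beta> * xs r = real (v r) + xs (Suc r)" for r
    using pos[of r] by (simp add: v_def xs_def T_def)
  then have val: "val ((shift ^^ r) v) = xs r" for r
    using v xs by (intro val_eqI)
  have "xs (Suc r) < 1" for r using T by (simp add: xs_def)
  with val have tails: "val ((shift ^^ Suc r) v) < 1" for r by metis
  have "val v = x" using val[of 0] by (simp add: xs_def)
  then have "greedy k \<beta> x = v" using greedy_eqI[OF v tails] by simp
  then show "greedy k \<beta> x \<in> seqs k" "val (greedy k \<beta> x) = x"
    "val ((shift ^^ Suc r) (greedy k \<beta> x)) < 1"
    using v tails \<open>val v = x\<close> by simp_all
qed

text \<open>Rounding up instead of down yields expansions that do not end in zeros. The expansion of
  \<open>1\<close> obtained in this way is the maximal sequence bounding the greedy expansions.\<close>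

definition qg_map :: "real \<Rightarrow> real" where
  "qg_map y = \<beta> * y - (of_int \<lceil>\<beta> * y\<rceil> - 1)"

definition quasi_greedy :: "real \<Rightarrow> nat \<Rightarrow> nat" where
  "quasi_greedy y r = nat (\<lceil>\<beta> * (qg_map ^^ r) y\<rceil> - 1)"

lemma qg_map_funpow:
  assumes "0 < y" "y \<le> 1"
  shows "0 < (qg_map ^^ r) y" "(qg_map ^^ r) y \<le> 1"
proof -
  have "0 < qg_map z" "qg_map z \<le> 1" for z
    unfolding qg_map_def by linarith+
  then show "0 < (qg_map ^^ r) y" "(qg_map ^^ r) y \<le> 1"
    using assms by (cases r; simp)+
qed

lemma shift_quasi_greedy: "(shift ^^ r) (quasi_greedy y) = quasi_greedy ((qg_map ^^ r) y)"
  by (simp add: shift_funpow quasi_greedy_def fun_eq_iff funpow_add)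

lemma quasi_greedy_less:
  assumes "0 < y" "y \<le> 1"
  shows "quasi_greedy y r < k"
proof -
  have "\<beta> * (qg_map ^^ r) y \<le> \<beta>" "0 < \<beta> * (qg_map ^^ r) y"
    using qg_map_funpow[OF assms, of r] \<beta>_gt_1 by (auto intro: mult_left_le)
  then have "0 < \<beta> * (qg_map ^^ r) y" "\<beta> * (qg_map ^^ r) y \<le> real k" using \<beta>_less by linarith+
  then have "\<lceil>\<beta> * (qg_map ^^ r) y\<rceil> \<le> int k" by (simp add: ceiling_le_iff)
  then show ?thesis unfolding quasi_greedy_def using k2 by linarith
qed

lemma quasi_greedy_rec:
  assumes "0 < y" "y \<le> 1"
  shows "\<beta> * (qg_map ^^ r) y = real (quasi_greedy y r) + (qg_map ^^ Suc r) y"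
proof -
  have "0 < \<beta> * (qg_map ^^ r) y" using qg_map_funpow[OF assms, of r] \<beta>_gt_1 by simp
  then have "1 \<le> \<lceil>\<beta> * (qg_map ^^ r) y\<rceil>" by linarith
  then have "real (quasi_greedy y r) = of_int \<lceil>\<beta> * (qg_map ^^ r) y\<rceil> - 1"
    unfolding quasi_greedy_def by simp
  then show ?thesis by (simp add: qg_map_def)
qed

text \<open>While the digits agree, both orbits undergo the same increasing affine map and stay in
  order; so do their ceilings at the first difference.\<close>

lemma quasi_greedy_mono:
  assumes "0 < y" "y \<le> z" "z \<le> 1"
  shows "quasi_greedy y \<preceq> quasi_greedy z"
proof (rule ccontr)
  assume "\<not> quasi_greedy y \<preceq> quasi_greedy z"
  then have "less_fun (quasi_greedy z) (quasi_greedy y)" using lex_linear by blast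
  then obtain i where i: "quasi_greedy z i < quasi_greedy y i"
    "\<And>j. j < i \<Longrightarrow> quasi_greedy z j = quasi_greedy y j" by (auto elim: less_funE)
  have "(qg_map ^^ j) y \<le> (qg_map ^^ j) z" if "j \<le> i" for j
    using that
  proof (induction j)
    case (Suc j)
    have "\<beta> * (qg_map ^^ j) y \<le> \<beta> * (qg_map ^^ j) z" using Suc \<beta>_gt_1 by simp
    then show ?case
      using quasi_greedy_rec[of y j] quasi_greedy_rec[of z j] i(2)[of j] Suc.prems assms by simp
  qed (use assms in simp)
  from this[of i] have "\<beta> * (qg_map ^^ i) y \<le> \<beta> * (qg_map ^^ i) z" using \<beta>_gt_1 by simp
  then have "quasi_greedy y i \<le> quasi_greedy z i"
    unfolding quasi_greedy_def by (intro nat_mono diff_right_mono ceiling_mono)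
  with i(1) show False by simp
qed

section \<open>The bounding sequence of base \<beta>\<close>

definition w_max :: "nat \<Rightarrow> nat" where
  "w_max = quasi_greedy 1"

text \<open>Shifts of \<open>w_max\<close> are quasi-greedy expansions of orbit points in (0, 1], so
  monotonicity gives maximality.\<close>

lemma w_max_maximal: "w_max \<in> maximal_seqs k"
proof -
  have "\<lceil>\<beta>\<rceil> = int k" using \<beta>_gt \<beta>_less by (intro ceiling_unique) auto
  then have "w_max 0 = k - 1" by (simp add: w_max_def quasi_greedy_def nat_diff_distrib)
  moreover have "(shift ^^ r) w_max \<preceq> w_max" for r
    unfolding w_max_def shift_quasi_greedy using qg_map_funpow[of 1 r]
    by (intro quasi_greedy_mono) auto
  ultimately show ?thesis
    using quasi_greedy_less[of 1] by (simp add: maximal_seqs_def seqs_def w_max_def)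
qed

text \<open>At the first difference v loses at least 1 against \<open>w_max\<close>, whose remaining
  tail still has a value x > 0. An excess of \<open>val v\<close> over 1, magnified by
  \<open>\<beta> ^ Suc i\<close>, thus reappears in a later tail with x to spare.\<close>

lemma val_less_1_step:
  assumes v: "v \<in> seqs k" and less: "less_fun v w_max"
  shows "\<exists>i x. 0 < x \<and> 1 + x - val ((shift ^^ Suc i) v) \<le> \<beta> ^ Suc i * (1 - val v)"
proof -
  have w: "w_max \<in> seqs k" using w_max_maximal by (simp add: maximal_seqs_def)
  have val_w: "val ((shift ^^ r) w_max) = (qg_map ^^ r) 1" for r
    using w quasi_greedy_rec[of 1] qg_map_funpow[of 1]
    by (intro val_eqI) (auto simp: w_max_def less_imp_le simp del: funpow.simps)
  obtain i where i: "v i < w_max i" "\<And>j. j < i \<Longrightarrow> v j = w_max j"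
    using less by (auto elim: less_funE)
  have "\<beta> ^ i * (val w_max - val v) = val ((shift ^^ i) w_max) - val ((shift ^^ i) v)"
    using i(2) by (intro val_diff w v) simp
  then have "\<beta> ^ Suc i * (val w_max - val v)
      = \<beta> * val ((shift ^^ i) w_max) - \<beta> * val ((shift ^^ i) v)"
    by (metis mult.assoc power_Suc right_diff_distrib)
  also have "\<dots> = real (w_max i) - real (v i) + (qg_map ^^ Suc i) 1 - val ((shift ^^ Suc i) v)"
    unfolding val_w val_Suc[OF v] using quasi_greedy_rec[of 1 i] by (simp add: w_max_def)
  also have "\<dots> \<ge> 1 + (qg_map ^^ Suc i) 1 - val ((shift ^^ Suc i) v)" using i(1) by simp
  finally have "1 + (qg_map ^^ Suc i) 1 - val ((shift ^^ Suc i) v) \<le> \<beta> ^ Suc i * (1 - val v)"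
    using val_w[of 0] by simp
  then show ?thesis using qg_map_funpow[of 1 "Suc i"] by (intro exI[of _ i] exI[of _ "(qg_map ^^ Suc i) 1"]) simp
qed

text \<open>A positive excess over 1 would grow without bound along later tails, whose values are
  bounded. So no tail exceeds 1, and one more step with its positive x gives strictness.\<close>

lemma val_less_1:
  assumes v: "v \<in> seqs k" and less: "\<And>r. less_fun ((shift ^^ r) v) w_max"
  shows "val ((shift ^^ r) v) < 1"
proof -
  define y where "y r = val ((shift ^^ r) v) - 1" for r
  have step: "\<exists>i x. 0 < x \<and> \<beta> ^ Suc i * y r \<le> y (r + Suc i) - x" for r
  proof -
    obtain i x where "0 < x"
      "1 + x - val ((shift ^^ Suc i) ((shift ^^ r) v)) \<le> \<beta> ^ Suc i * (1 - val ((shift ^^ r) v))"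
      using val_less_1_step[OF shift_seqs[OF v] less] by blast
    moreover have "(shift ^^ Suc i) ((shift ^^ r) v) = (shift ^^ (r + Suc i)) v"
      by (simp add: shift_funpow add.commute add.left_commute)
    ultimately show ?thesis
      by (intro exI[of _ i] exI[of _ x]) (simp add: y_def algebra_simps)
  qed
  define B where "B = (\<Sum>r. real k / \<beta> ^ (r + 1))"
  have "0 \<le> B" unfolding B_def using summable_bound \<beta>_gt_1 by (intro suminf_nonneg) auto
  have yB: "\<beta> ^ n * y r \<le> B" for n r
  proof (induction n arbitrary: r)
    case 0
    show ?case using val_le[OF shift_seqs[OF v], of r] by (simp add: y_def B_def)
  next
    case (Suc n)
    show ?case
    proof (cases "0 < y r")
      case True
      obtain i x where ix: "0 < x" "\<beta> ^ Suc i * y r \<le> y (r + Suc i) - x" using step by blast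
      \<comment> \<open>Using one factor \<beta> per jump frees the induction from the jump
        lengths.\<close>
      have "\<beta> * y r \<le> \<beta> ^ Suc i * y r"
        using True \<beta>_gt_1 by (intro mult_right_mono) (auto simp: one_le_power)
      with ix have "\<beta> * y r \<le> y (r + Suc i)" by linarith
      then have "\<beta> ^ n * (\<beta> * y r) \<le> \<beta> ^ n * y (r + Suc i)"
        using \<beta>_gt_1 by (intro mult_left_mono) auto
      then show ?thesis using Suc[of "r + Suc i"] by (simp add: mult_ac)
    next
      case False
      then have "\<beta> ^ Suc n * y r \<le> 0" using \<beta>_gt_1 by (intro mult_nonneg_nonpos) auto
      then show ?thesis using \<open>0 \<le> B\<close> by linarith
    qed
  qed
  have y0: "y r \<le> 0" for r
  proof (rule ccontr)
    assume "\<not> y r \<le> 0"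
    moreover obtain n where "B / y r < \<beta> ^ n" using real_arch_pow[OF \<beta>_gt_1] by blast
    ultimately have "B < \<beta> ^ n * y r" by (simp add: field_simps)
    with yB[of n r] show False by simp
  qed
  obtain i x where "0 < x" "\<beta> ^ Suc i * y r \<le> y (r + Suc i) - x" using step by blast
  then have "\<beta> ^ Suc i * y r < 0" using y0[of "r + Suc i"] by linarith
  then have "y r < 0" using \<beta>_gt_1 by (simp add: mult_less_0_iff)
  then show ?thesis by (simp add: y_def)
qed

text \<open>A tail of value 0 consists of zeros. If there is none, all tails have values in (0, 1],
  so the greedy digits agree with those obtained by rounding up.\<close>

lemma greedy_cases:
  assumes "0 \<le> x" "x \<le> 1"
  shows "greedy k \<beta> x \<in> beta_shift k w_max \<or> (\<exists>R. \<forall>r\<ge>R. greedy k \<beta> x r = 0)"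
proof (cases "\<exists>R. val ((shift ^^ R) (greedy k \<beta> x)) = 0")
  case True
  define v where "v = greedy k \<beta> x"
  have v: "v \<in> seqs k" using greedy_expansion[OF assms] by (simp add: v_def)
  obtain R where R: "val ((shift ^^ R) v) = 0" using True v_def by blast
  have z: "v r = 0 \<and> val ((shift ^^ Suc r) v) = 0" if "val ((shift ^^ r) v) = 0" for r
    using val_Suc[OF v, of r] val_nonneg[OF shift_seqs[OF v], of "Suc r"] that by simp
  have "val ((shift ^^ (R + n)) v) = 0" for n
    by (induction n) (use R z in auto)
  then have "v r = 0" if "r \<ge> R" for r using z that by (metis le_iff_add)
  then show ?thesis unfolding v_def by blast
next
  case False
  define v where "v = greedy k \<beta> x"
  define y where "y r = val ((shift ^^ r) v)" for r
  note g = greedy_expansion[OF assms, folded v_def]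
  have y_pos: "0 < y r" for r
    using val_nonneg[OF shift_seqs[OF g(1)], of r] False by (auto simp: y_def v_def less_le)
  have rec: "\<beta> * y r = real (v r) + y (Suc r)" for r
    unfolding y_def by (rule val_Suc[OF g(1)])
  have y_le: "y r \<le> 1" for r
    using g(2,3) assms by (cases r) (auto simp: y_def less_imp_le simp del: funpow.simps(2))
  have ceil: "\<lceil>\<beta> * y r\<rceil> = int (v r) + 1" for r
    using rec[of r] y_pos[of "Suc r"] y_le[of "Suc r"] by (intro ceiling_unique) auto
  have iter: "(qg_map ^^ r) (y 0) = y r" for r
  proof (induction r)
    case (Suc r)
    have "qg_map (y r) = y (Suc r)" unfolding qg_map_def ceil using rec[of r] by simp
    then show ?case using Suc by simp
  qed simp
  have "v = quasi_greedy (y 0)"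
    by (auto simp: fun_eq_iff quasi_greedy_def iter ceil)
  then have "(shift ^^ r) v = quasi_greedy (y r)" for r
    using iter by (simp add: shift_quasi_greedy)
  then have "(shift ^^ r) v \<preceq> w_max" for r
    unfolding w_max_def using y_pos y_le by (simp add: quasi_greedy_mono)
  then show ?thesis using g(1) by (simp add: beta_shift_def v_def)
qed

lemma eventually_zero_freq:
  assumes "has_subseq_freq k v \<alpha>" "\<And>r. r \<ge> R \<Longrightarrow> v r = 0"
  shows "\<alpha> (k - 1) = 0"
proof -
  obtain \<rho> :: "nat \<Rightarrow> nat" where \<rho>: "filterlim \<rho> at_top sequentially"
    "(\<lambda>s. real (digit_count (k - 1) (\<rho> s) v) / real (\<rho> s)) \<longlonglongrightarrow> \<alpha> (k - 1)"
    using assms(1) k_diff_simps unfolding has_subseq_freq_def by blast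
  have "digit_count (k - 1) r v \<le> R" for r
  proof -
    have "j < R" if "v j = k - 1" for j
    proof (rule ccontr)
      assume "\<not> j < R"
      then show False using assms(2)[of j] that k2 by simp
    qed
    then have "{j. j < r \<and> v j = k - 1} \<subseteq> {..<R}" by blast
    from card_mono[OF finite_lessThan this] show ?thesis by (simp add: digit_count_def)
  qed
  then have le: "norm (real (digit_count (k - 1) (\<rho> s) v) / real (\<rho> s)) \<le> real R / real (\<rho> s)" for s
    by (simp add: divide_right_mono)
  have "(\<lambda>s. real R / real (\<rho> s)) \<longlonglongrightarrow> 0"
    using filterlim_compose[OF filterlim_real_sequentially \<rho>(1)]
    by (intro real_tendsto_divide_at_top[OF tendsto_const])
  then have "(\<lambda>s. real (digit_count (k - 1) (\<rho> s) v) / real (\<rho> s)) \<longlonglongrightarrow> 0"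
    by (rule Lim_null_comparison[OF always_eventually[OF allI[OF le]]])
  with \<rho>(2) show ?thesis by (rule LIMSEQ_unique)
qed

theorem DF_beta_eq:
  shows "DF_beta k \<beta> = DF k w_max" "DF_beta' k \<beta> = DF k w_max"
proof -
  have w0: "w_max 0 = k - 1" using w_max_maximal by (simp add: maximal_seqs_def)
  have "DF_beta' k \<beta> \<subseteq> DF k w_max"
  proof
    fix \<alpha> assume "\<alpha> \<in> DF_beta' k \<beta>"
    then obtain x where \<alpha>: "\<alpha> \<in> freq_simplex k" and x: "0 \<le> x" "x \<le> 1"
      and freq: "has_subseq_freq k (greedy k \<beta> x) \<alpha>" by (auto simp: DF_beta'_def)
    have "inf_seq k \<alpha> \<preceq> w_max"
    proof (cases "greedy k \<beta> x \<in> beta_shift k w_max")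
      case True
      then show ?thesis using inf_seq_le_if_subseq_freq[of w_max, OF w0 _ \<alpha> freq] by simp
    next
      case False
      then obtain R where "\<forall>r\<ge>R. greedy k \<beta> x r = 0" using greedy_cases[OF x] by blast
      then have "\<alpha> (k - 1) = 0" using eventually_zero_freq[OF freq] by blast
      \<comment> \<open>This is the least sequence starting with k - 1, hence not above
        \<open>w_max\<close>.\<close>
      then have I: "inf_seq k \<alpha> = (\<lambda>m. if m = 0 then k - 1 else 0)" by (simp add: inf_seq_def)
      have "\<not> less_fun w_max (inf_seq k \<alpha>)"
        using w0 unfolding I by (auto elim!: less_funE split: if_splits)
      then show ?thesis using lex_linear by blast
    qed
    then show "\<alpha> \<in> DF k w_max" using \<alpha> by (simp add: DF_eq(2)[of w_max, OF w0])
  qed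
  moreover have "DF k w_max \<subseteq> DF_beta k \<beta>"
  proof
    fix \<alpha> assume "\<alpha> \<in> DF k w_max"
    then have \<alpha>: "\<alpha> \<in> freq_simplex k" "inf_seq k \<alpha> \<preceq> w_max" by (auto simp: DF_eq(2)[of w_max, OF w0])
    obtain v where v: "v \<in> seqs k" "\<And>r. less_fun ((shift ^^ r) v) (inf_seq k \<alpha>)" "has_freq k v \<alpha>"
      using exists_strictly_below_inf_seq[OF \<alpha>(1)] by blast
    \<comment> \<open>Strictness below I(\<alpha>) enters here: it bounds all tails by less than 1,
      the criterion for v to be greedy.\<close>
    have lt: "val ((shift ^^ r) v) < 1" for r
      using less_fun_lex_le_trans[OF v(2) \<alpha>(2)] by (rule val_less_1[OF v(1)])
    then have "greedy k \<beta> (val v) = v" using v(1) by (intro greedy_eqI)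
    moreover have "val v \<in> {0..1}" using lt[of 0] val_nonneg[OF v(1)] by simp
    ultimately show "\<alpha> \<in> DF_beta k \<beta>" using \<alpha>(1) v(3) unfolding DF_beta_def by force
  qed
  moreover have "DF_beta k \<beta> \<subseteq> DF_beta' k \<beta>"
    unfolding DF_beta_def DF_beta'_def has_freq_def has_subseq_freq_def
    using filterlim_ident[of sequentially] by (auto intro!: bexI exI[of _ "\<lambda>r. r"])
  ultimately show "DF_beta k \<beta> = DF k w_max" "DF_beta' k \<beta> = DF k w_max" by auto
qed

end

theorem mainTheorem4:
  fixes k :: nat
  assumes "2 \<le> k"
  shows "(\<forall>w \<in> maximal_seqs k.
            DF' k w = {\<alpha> \<in> freq_simplex k. inf_seq k \<alpha> \<preceq> w} \<and>
            {\<alpha> \<in> freq_simplex k. inf_seq k \<alpha> \<preceq> w} = DF k w) \<and>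
         (\<forall>\<beta>::real. real k - 1 < \<beta> \<and> \<beta> < real k \<longrightarrow>
            (\<exists>w \<in> maximal_seqs k. DF_beta k \<beta> = DF k w) \<and> DF_beta' k \<beta> = DF_beta k \<beta>)"
proof (intro conjI ballI allI impI)
  interpret digit_alphabet k by unfold_locales fact
  fix w assume "w \<in> maximal_seqs k"
  then have "w 0 = k - 1" by (simp add: maximal_seqs_def)
  from DF_eq[of w, OF this]
  show "DF' k w = {\<alpha> \<in> freq_simplex k. inf_seq k \<alpha> \<preceq> w}"
    "{\<alpha> \<in> freq_simplex k. inf_seq k \<alpha> \<preceq> w} = DF k w" by auto
next
  fix \<beta> :: real assume "real k - 1 < \<beta> \<and> \<beta> < real k"
  then interpret beta_expansion k \<beta> using assms by unfold_locales auto
  show "\<exists>w \<in> maximal_seqs k. DF_beta k \<beta> = DF k w" "DF_beta' k \<beta> = DF_beta k \<beta>"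
    using DF_beta_eq w_max_maximal by auto
qed

end
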